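(* There exist a Banach lattice $X$, on which the sequential Lorentz seminorm is not a norm, and positive operators $A$ and $B$ on $X$ such that: (i) $0 \leq A \leq B$; (ii) $\rho(A) = \rho(B) = 1$; (iii) $\rho(B)$ is a pole of the resolvent $R(\lambda,B)$ of multiplicity one; (iv) $B$ is order continuous; (v) $B$ is band irreducible; and nevertheless $A \neq B$.
   Context: For a bounded operator $T$ on a Banach lattice, $\rho(T)$ denotes its spectral radius and $R(\lambda,T) = (\lambda I - T)^{-1}$ its resolvent (spectral notions are taken in the complexification if the lattice is real). The multiplicity of a pole of the resolvent means its order. A positive operator $T$ on $X$ is band irreducible if it leaves invariant no band of $X$ other than $\{0\}$ and $X$. A positive operator $T$ on $X$ is order continuous if for every net $x_\alpha \downarrow 0$ in $X$ one has $Tx_\alpha \downarrow 0$. The sequential Lorentz seminorm $l$ on $X$ is defined by $$l(x) = \inf_{x_n \uparrow |x|} \ \lim_{n} \|x_n\|, \quad x \in X,$$ where the infimum is taken over all sequences $\{x_n\} \subset X$ such that $x_n \geq 0$ and $x_n \uparrow |x|$. *)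

theory Defs
  imports Complex_Main "HOL-Algebra.Module"
begin

section \<open>Normed spaces and Banach lattices with explicit carriers\<close>

text \<open>
  The main theorem asserts the existence of a Banach lattice, so the space has to be a value over
  which one can quantify, not a type. Normed spaces therefore extend the module records of
  HOL-Algebra; as for every module there, the ring multiplication and unit inherited from the
  record hierarchy are not used.
\<close>

record ('s, 'v) normed_module = "('s, 'v) module" +
  vnorm :: "'v \<Rightarrow> real"

record 'v normed_lattice = "(real, 'v) normed_module" +
  vle :: "'v \<Rightarrow> 'v \<Rightarrow> bool"

definition scalar_ring :: "'s::field ring" where
  "scalar_ring = \<lparr>carrier = UNIV, monoid.mult = (*), one = 1, zero = 0, add = (+)\<rparr>"

lemma cring_scalar_ring: "cring (scalar_ring :: 's::field ring)"
proof (rule cringI)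
  show "abelian_group (scalar_ring :: 's ring)"
  proof (rule abelian_groupI)
    fix x :: 's
    show "\<exists>y\<in>carrier scalar_ring. y \<oplus>\<^bsub>scalar_ring\<^esub> x = \<zero>\<^bsub>scalar_ring\<^esub>"
      by (rule bexI[of _ "- x"]) (simp_all add: scalar_ring_def)
  qed (simp_all add: scalar_ring_def algebra_simps)
  show "Group.comm_monoid (scalar_ring :: 's ring)"
    by (rule comm_monoidI) (simp_all add: scalar_ring_def algebra_simps)
qed (simp add: scalar_ring_def algebra_simps)

definition seminorm_on ::
    "('s::real_normed_field, 'v, 'm) normed_module_scheme \<Rightarrow> ('v \<Rightarrow> real) \<Rightarrow> bool" where
  "seminorm_on V p \<longleftrightarrow>
     (\<forall>x\<in>carrier V. 0 \<le> p x) \<and>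
     (\<forall>x\<in>carrier V. \<forall>c. p (c \<odot>\<^bsub>V\<^esub> x) = norm c * p x) \<and>
     (\<forall>x\<in>carrier V. \<forall>y\<in>carrier V. p (x \<oplus>\<^bsub>V\<^esub> y) \<le> p x + p y)"

definition norm_on ::
    "('s::real_normed_field, 'v, 'm) normed_module_scheme \<Rightarrow> ('v \<Rightarrow> real) \<Rightarrow> bool" where
  "norm_on V p \<longleftrightarrow> seminorm_on V p \<and> (\<forall>x\<in>carrier V. p x = 0 \<longrightarrow> x = \<zero>\<^bsub>V\<^esub>)"

definition norm_complete ::
    "('s::real_normed_field, 'v, 'm) normed_module_scheme \<Rightarrow> bool" where
  "norm_complete V \<longleftrightarrow>
     (\<forall>x::nat \<Rightarrow> 'v.
        (\<forall>n. x n \<in> carrier V) \<and>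
        (\<forall>e>0. \<exists>N. \<forall>m\<ge>N. \<forall>n\<ge>N. vnorm V (x m \<ominus>\<^bsub>V\<^esub> x n) < e) \<longrightarrow>
        (\<exists>l\<in>carrier V. (\<lambda>n. vnorm V (x n \<ominus>\<^bsub>V\<^esub> l)) \<longlonglongrightarrow> 0))"

definition is_supremum :: "('v, 'm) normed_lattice_scheme \<Rightarrow> 'v set \<Rightarrow> 'v \<Rightarrow> bool" where
  "is_supremum X S u \<longleftrightarrow>
     u \<in> carrier X \<and> (\<forall>s\<in>S. vle X s u) \<and>
     (\<forall>v\<in>carrier X. (\<forall>s\<in>S. vle X s v) \<longrightarrow> vle X u v)"

definition is_infimum :: "('v, 'm) normed_lattice_scheme \<Rightarrow> 'v set \<Rightarrow> 'v \<Rightarrow> bool" where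
  "is_infimum X S u \<longleftrightarrow>
     u \<in> carrier X \<and> (\<forall>s\<in>S. vle X u s) \<and>
     (\<forall>v\<in>carrier X. (\<forall>s\<in>S. vle X v s) \<longrightarrow> vle X v u)"

definition modulus :: "('v, 'm) normed_lattice_scheme \<Rightarrow> 'v \<Rightarrow> 'v" where
  "modulus X x = (THE u. is_supremum X {x, \<ominus>\<^bsub>X\<^esub> x} u)"

locale banach_lattice = Module.module scalar_ring X
  for X :: "('v, 'm) normed_lattice_scheme" (structure) +
  assumes le_refl: "reflp_on (carrier X) (vle X)"
    and le_antisym: "antisymp_on (carrier X) (vle X)"
    and le_trans: "transp_on (carrier X) (vle X)"
    and le_add:
      "\<lbrakk>x \<in> carrier X; y \<in> carrier X; z \<in> carrier X; vle X x y\<rbrakk> \<Longrightarrow> vle X (x \<oplus> z) (y \<oplus> z)"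
    and le_smult:
      "\<lbrakk>x \<in> carrier X; y \<in> carrier X; 0 \<le> c; vle X x y\<rbrakk> \<Longrightarrow> vle X (c \<odot> x) (c \<odot> y)"
    and sup_exists: "\<lbrakk>x \<in> carrier X; y \<in> carrier X\<rbrakk> \<Longrightarrow> \<exists>u. is_supremum X {x, y} u"
    and inf_exists: "\<lbrakk>x \<in> carrier X; y \<in> carrier X\<rbrakk> \<Longrightarrow> \<exists>u. is_infimum X {x, y} u"
    and norm: "norm_on X (vnorm X)"
    and norm_mono:
      "\<lbrakk>x \<in> carrier X; y \<in> carrier X; vle X (modulus X x) (modulus X y)\<rbrakk>
        \<Longrightarrow> vnorm X x \<le> vnorm X y"
    and complete: "norm_complete X"

text \<open>The limit below exists, since the norms increase and are bounded by the norm of \<open>x\<close>.\<close>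

definition lorentz_seminorm :: "('v, 'm) normed_lattice_scheme \<Rightarrow> 'v \<Rightarrow> real" where
  "lorentz_seminorm X x =
     Inf {lim (\<lambda>n. vnorm X (xs n)) | xs :: nat \<Rightarrow> 'v.
            (\<forall>n. xs n \<in> carrier X \<and> vle X \<zero>\<^bsub>X\<^esub> (xs n) \<and> vle X (xs n) (xs (Suc n))) \<and>
            is_supremum X (range xs) (modulus X x)}"


section \<open>Operators on Banach lattices\<close>

text \<open>Operators are HOL functions that matter only on the carrier.\<close>

definition linear_operator :: "('s, 'v, 'm) module_scheme \<Rightarrow> ('v \<Rightarrow> 'v) \<Rightarrow> bool" where
  "linear_operator V T \<longleftrightarrow>
     T \<in> carrier V \<rightarrow> carrier V \<and>
     (\<forall>x\<in>carrier V. \<forall>y\<in>carrier V. T (x \<oplus>\<^bsub>V\<^esub> y) = T x \<oplus>\<^bsub>V\<^esub> T y) \<and>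
     (\<forall>c. \<forall>x\<in>carrier V. T (c \<odot>\<^bsub>V\<^esub> x) = c \<odot>\<^bsub>V\<^esub> T x)"

definition operator_le ::
    "('v, 'm) normed_lattice_scheme \<Rightarrow> ('v \<Rightarrow> 'v) \<Rightarrow> ('v \<Rightarrow> 'v) \<Rightarrow> bool" where
  "operator_le X S T \<longleftrightarrow> (\<forall>x\<in>carrier X. vle X \<zero>\<^bsub>X\<^esub> x \<longrightarrow> vle X (S x) (T x))"

definition positive_operator :: "('v, 'm) normed_lattice_scheme \<Rightarrow> ('v \<Rightarrow> 'v) \<Rightarrow> bool" where
  "positive_operator X T \<longleftrightarrow> linear_operator X T \<and> operator_le X (\<lambda>_. \<zero>\<^bsub>X\<^esub>) T"

definition lattice_ideal :: "('v, 'm) normed_lattice_scheme \<Rightarrow> 'v set \<Rightarrow> bool" where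
  "lattice_ideal X J \<longleftrightarrow>
     submodule J scalar_ring X \<and>
     (\<forall>x\<in>J. \<forall>y\<in>carrier X. vle X (modulus X y) (modulus X x) \<longrightarrow> y \<in> J)"

definition lattice_band :: "('v, 'm) normed_lattice_scheme \<Rightarrow> 'v set \<Rightarrow> bool" where
  "lattice_band X J \<longleftrightarrow>
     lattice_ideal X J \<and> (\<forall>D u. D \<subseteq> J \<and> is_supremum X D u \<longrightarrow> u \<in> J)"

definition band_irreducible :: "('v, 'm) normed_lattice_scheme \<Rightarrow> ('v \<Rightarrow> 'v) \<Rightarrow> bool" where
  "band_irreducible X T \<longleftrightarrow>
     (\<forall>J. lattice_band X J \<and> T ` J \<subseteq> J \<longrightarrow> J = {\<zero>\<^bsub>X\<^esub>} \<or> J = carrier X)"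

definition directed_index_set :: "'i set \<Rightarrow> ('i \<Rightarrow> 'i \<Rightarrow> bool) \<Rightarrow> bool" where
  "directed_index_set I r \<longleftrightarrow>
     I \<noteq> {} \<and> reflp_on I r \<and> transp_on I r \<and> (\<forall>i\<in>I. \<forall>j\<in>I. \<exists>k\<in>I. r i k \<and> r j k)"

definition net_decreases_to_zero ::
    "('v, 'm) normed_lattice_scheme \<Rightarrow> 'i set \<Rightarrow> ('i \<Rightarrow> 'i \<Rightarrow> bool) \<Rightarrow> ('i \<Rightarrow> 'v) \<Rightarrow> bool" where
  "net_decreases_to_zero X I r x \<longleftrightarrow>
     x \<in> I \<rightarrow> carrier X \<and>
     (\<forall>i\<in>I. \<forall>j\<in>I. r i j \<longrightarrow> vle X (x j) (x i)) \<and>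
     is_infimum X (x ` I) \<zero>\<^bsub>X\<^esub>"

text \<open>
  A definition cannot quantify over the type of the index set. Taking indices in the space itself
  loses nothing: a decreasing net may be reindexed by the set of its values, directed downwards.
\<close>

definition order_continuous :: "('v, 'm) normed_lattice_scheme \<Rightarrow> ('v \<Rightarrow> 'v) \<Rightarrow> bool" where
  "order_continuous X T \<longleftrightarrow>
     (\<forall>(I :: 'v set) r x. directed_index_set I r \<and> net_decreases_to_zero X I r x \<longrightarrow>
        net_decreases_to_zero X I r (\<lambda>i. T (x i)))"


section \<open>Spectral notions\<close>

text \<open>
  The pair \<open>(x, y)\<close> stands for \<open>x + \<i> y\<close>. Its modulus is the supremum of
  \<open>cos t \<cdot> x + sin t \<cdot> y\<close> over all real \<open>t\<close>, which exists in every Banach lattice.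
\<close>

definition complex_modulus :: "('v, 'm) normed_lattice_scheme \<Rightarrow> 'v \<times> 'v \<Rightarrow> 'v" where
  "complex_modulus X z =
     (THE u. is_supremum X (range (\<lambda>t::real. (cos t \<odot>\<^bsub>X\<^esub> fst z) \<oplus>\<^bsub>X\<^esub> (sin t \<odot>\<^bsub>X\<^esub> snd z))) u)"

definition complexification ::
    "('v, 'm) normed_lattice_scheme \<Rightarrow> (complex, 'v \<times> 'v) normed_module" where
  "complexification X =
     \<lparr>carrier = carrier X \<times> carrier X,
      monoid.mult = undefined,
      one = undefined,
      zero = (\<zero>\<^bsub>X\<^esub>, \<zero>\<^bsub>X\<^esub>),
      add = (\<lambda>z w. (fst z \<oplus>\<^bsub>X\<^esub> fst w, snd z \<oplus>\<^bsub>X\<^esub> snd w)),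
      smult = (\<lambda>c z. ((Re c \<odot>\<^bsub>X\<^esub> fst z) \<ominus>\<^bsub>X\<^esub> (Im c \<odot>\<^bsub>X\<^esub> snd z),
                      (Re c \<odot>\<^bsub>X\<^esub> snd z) \<oplus>\<^bsub>X\<^esub> (Im c \<odot>\<^bsub>X\<^esub> fst z))),
      vnorm = (\<lambda>z. vnorm X (complex_modulus X z))\<rparr>"

definition complexify_operator :: "('v \<Rightarrow> 'v) \<Rightarrow> 'v \<times> 'v \<Rightarrow> 'v \<times> 'v" where
  "complexify_operator T = map_prod T T"

definition bounded_operator ::
    "('s::real_normed_field, 'v, 'm) normed_module_scheme \<Rightarrow> ('v \<Rightarrow> 'v) \<Rightarrow> bool" where
  "bounded_operator V T \<longleftrightarrow>
     linear_operator V T \<and> (\<exists>K. \<forall>x\<in>carrier V. vnorm V (T x) \<le> K * vnorm V x)"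

definition operator_norm ::
    "('s::real_normed_field, 'v, 'm) normed_module_scheme \<Rightarrow> ('v \<Rightarrow> 'v) \<Rightarrow> real" where
  "operator_norm V T = Sup {vnorm V (T x) | x. x \<in> carrier V \<and> vnorm V x \<le> 1}"

definition resolvent_set ::
    "(complex, 'v, 'm) normed_module_scheme \<Rightarrow> ('v \<Rightarrow> 'v) \<Rightarrow> complex set" where
  "resolvent_set V T =
     {c. \<exists>S. bounded_operator V S \<and>
          (\<forall>x\<in>carrier V. S ((c \<odot>\<^bsub>V\<^esub> x) \<ominus>\<^bsub>V\<^esub> T x) = x \<and> (c \<odot>\<^bsub>V\<^esub> S x) \<ominus>\<^bsub>V\<^esub> T (S x) = x)}"

definition op_resolvent ::
    "(complex, 'v, 'm) normed_module_scheme \<Rightarrow> complex \<Rightarrow> ('v \<Rightarrow> 'v) \<Rightarrow> 'v \<Rightarrow> 'v" where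
  "op_resolvent V c T = inv_into (carrier V) (\<lambda>x. (c \<odot>\<^bsub>V\<^esub> x) \<ominus>\<^bsub>V\<^esub> T x)"

definition op_spectrum ::
    "(complex, 'v, 'm) normed_module_scheme \<Rightarrow> ('v \<Rightarrow> 'v) \<Rightarrow> complex set" where
  "op_spectrum V T = - resolvent_set V T"

definition op_spectral_radius :: "('v, 'm) normed_lattice_scheme \<Rightarrow> ('v \<Rightarrow> 'v) \<Rightarrow> real" where
  "op_spectral_radius X T =
     Sup (cmod ` op_spectrum (complexification X) (complexify_operator T))"

text \<open>
  A pole of order \<open>m\<close> at \<open>a\<close>: on a punctured disc about \<open>a\<close> the resolvent exists and has a Laurent
  expansion, convergent in operator norm, whose first nonzero coefficient belongs to the exponent
  \<open>-m\<close>. Here \<open>C k\<close> is the coefficient of the power with exponent \<open>k - m\<close>.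
\<close>

definition resolvent_pole_of_order ::
    "(complex, 'v, 'm) normed_module_scheme \<Rightarrow> ('v \<Rightarrow> 'v) \<Rightarrow> complex \<Rightarrow> nat \<Rightarrow> bool" where
  "resolvent_pole_of_order V T a m \<longleftrightarrow>
     0 < m \<and>
     (\<exists>r>0. \<exists>C :: nat \<Rightarrow> 'v \<Rightarrow> 'v.
        (\<forall>k. bounded_operator V (C k)) \<and>
        (\<exists>x\<in>carrier V. C 0 x \<noteq> \<zero>\<^bsub>V\<^esub>) \<and>
        (\<forall>c. 0 < cmod (c - a) \<and> cmod (c - a) < r \<longrightarrow>
           c \<in> resolvent_set V T \<and>
           (\<lambda>n. operator_norm V (\<lambda>x. op_resolvent V c T x \<ominus>\<^bsub>V\<^esub>
              (\<Oplus>\<^bsub>V\<^esub>k\<in>{..<n}. ((c - a) powi (int k - int m)) \<odot>\<^bsub>V\<^esub> C k x))) \<longlonglongrightarrow> 0))"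

end

theory Submission
  imports Defs "HOL-Library.Nat_Bijection"
begin

text \<open>
  Let \<open>X\<close> be the space of real functions \<open>f\<close> on the finite words over the natural numbers such that
  \<open>f (s @ [n])\<close> tends to \<open>f s\<close> for every word \<open>s\<close> and \<open>\<bar>f s\<bar> / 2 ^ length s\<close> is bounded, with the
  pointwise order and the supremum of these quotients as norm. Norm limits are uniform on words of
  bounded length, so \<open>X\<close> is a Banach lattice. Each function is determined by its values at words of
  large length. Hence the constant function 1 is the supremum in \<open>X\<close> of an increasing sequence of
  functions that vanish at all words of length at most \<open>k\<close> and have norm at most \<open>1 / 2 ^ (k + 1)\<close>.
  As \<open>k\<close> is arbitrary, the Lorentz seminorm of 1 is 0.

  This leaves room for an order continuous operator that preserves a functional which is not order
  continuous, namely evaluation at the empty word. Let \<open>A f s\<close> be the value of \<open>f\<close> at \<open>s\<close> without its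
  first letter, \<open>A f [] = f []\<close>, and let \<open>B = A + C\<close> where \<open>C f (n # s)\<close> is a positive multiple of the value
  of \<open>f\<close> at the concatenation of the \<open>n\<close>-th word and \<open>s\<close>, and \<open>C f [] = 0\<close>. Both \<open>A\<close> and \<open>B\<close> preserve \<open>f []\<close>,
  so 1 belongs to both spectra although \<open>A \<noteq> B\<close>. Deleting a letter halves the weight, whence
  both operators contract the kernel of evaluation at the empty word by the factor \<open>3 / 4\<close>
  (\<open>norm_walk_le\<close>). The resolvent is thus a Neumann series on this kernel and has the single factor
  \<open>1 / (c - 1)\<close> on the complementary line of fixed vectors (\<open>walk_resolvent_def\<close>), which gives the
  spectral radius 1 and the simple pole (\<open>spectral_radius_walk\<close>, \<open>resolvent_pole_walk\<close>).

  Order continuity (\<open>order_continuous_walk\<close>) holds because a lower bound for the images \<open>B f\<close> of a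
  directed set yields lower bounds for the set itself, after restriction to a first letter and
  extension by zero from a subtree. As for irreducibility (\<open>band_irreducible_walk\<close>), \<open>C\<close> moves the
  positivity of \<open>f\<close> at any word to words of length one near the empty word, and the powers of \<open>A\<close> then
  spread it over a dense set of words.
\<close>

section \<open>Continuous functions on the tree of finite words\<close>

text \<open>
  The points are the finite words over \<open>nat\<close>, with the topology in which a set is open if with each
  word \<open>s\<close> it contains almost all children \<open>s @ [n]\<close>. The functions below are the continuous ones that
  grow at most like \<open>2 ^ length s\<close>. The words of length less than \<open>k\<close> form a closed set without
  interior, and the norm weighs down the rest by the factor \<open>1 / 2 ^ k\<close>. The value type is kept
  general because the complexification is the same space with complex values.
\<close>

definition tree_space :: "(nat list \<Rightarrow> 'a::real_normed_vector) set" where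
  "tree_space = {f. (\<forall>s. (\<lambda>n. f (s @ [n])) \<longlonglongrightarrow> f s) \<and>
                    (\<exists>K. \<forall>s. norm (f s) \<le> K * 2 ^ length s)}"

definition tree_norm :: "(nat list \<Rightarrow> 'a::real_normed_vector) \<Rightarrow> real" where
  "tree_norm f = (SUP s. norm (f s) / 2 ^ length s)"

lemma tree_spaceI:
  assumes "\<And>s. (\<lambda>n. f (s @ [n])) \<longlonglongrightarrow> f s" and "\<And>s. norm (f s) \<le> K * 2 ^ length s"
  shows "f \<in> tree_space"
  using assms unfolding tree_space_def by blast

lemma tree_space_limit: "f \<in> tree_space \<Longrightarrow> (\<lambda>n. f (s @ [n])) \<longlonglongrightarrow> f s"
  by (simp add: tree_space_def)

lemma tree_norm_le:
  assumes "\<And>s. norm (f s) \<le> K * 2 ^ length s"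
  shows "tree_norm f \<le> K"
  unfolding tree_norm_def using assms by (intro cSUP_least) (auto simp: divide_le_eq)

lemma norm_le_tree_norm:
  assumes "f \<in> tree_space"
  shows "norm (f s) \<le> tree_norm f * 2 ^ length s"
proof -
  obtain K where K: "\<And>s. norm (f s) \<le> K * 2 ^ length s"
    using assms unfolding tree_space_def by blast
  have "bdd_above (range (\<lambda>s. norm (f s) / 2 ^ length s))"
    using K by (intro bdd_aboveI[of _ K]) (auto simp: divide_le_eq)
  then have "norm (f s) / 2 ^ length s \<le> tree_norm f"
    unfolding tree_norm_def by (rule cSUP_upper[OF UNIV_I])
  then show ?thesis by (simp add: divide_le_eq)
qed

lemma tree_norm_nonneg: "f \<in> tree_space \<Longrightarrow> 0 \<le> tree_norm f"
  using norm_le_tree_norm[of f "[]"] norm_ge_zero[of "f []"] by (simp del: norm_ge_zero)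

lemma tree_space_const: "(\<lambda>_. a) \<in> tree_space"
  by (rule tree_spaceI[of _ "norm a"]) (auto simp: mult_le_cancel_left1)

lemma tree_space_add:
  assumes "f \<in> tree_space" "g \<in> tree_space"
  shows "(\<lambda>s. f s + g s) \<in> tree_space"
proof (rule tree_spaceI)
  show "norm (f s + g s) \<le> (tree_norm f + tree_norm g) * 2 ^ length s" for s
    using norm_triangle_ineq[of "f s" "g s"] norm_le_tree_norm[OF assms(1), of s]
      norm_le_tree_norm[OF assms(2), of s] by (simp add: distrib_right)
qed (intro tendsto_intros tree_space_limit assms)

lemma tree_space_compose:
  fixes f :: "nat list \<Rightarrow> 'a::real_normed_vector" and h :: "'a \<Rightarrow> 'b::real_normed_vector"
  assumes "f \<in> tree_space" and cont: "\<And>x. isCont h x" and bd: "\<And>x. norm (h x) \<le> L * norm x" "0 \<le> L"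
  shows "(\<lambda>s. h (f s)) \<in> tree_space"
proof (rule tree_spaceI)
  show "norm (h (f s)) \<le> (L * tree_norm f) * 2 ^ length s" for s
    using bd(1)[of "f s"] mult_left_mono[OF norm_le_tree_norm[OF assms(1), of s] bd(2)] by simp
  show "(\<lambda>n. h (f (s @ [n]))) \<longlonglongrightarrow> h (f s)" for s
    by (rule isCont_tendsto_compose[OF cont tree_space_limit[OF assms(1)]])
qed

lemma tree_space_mult:
  fixes c :: "'a::real_normed_field"
  shows "f \<in> tree_space \<Longrightarrow> (\<lambda>s. c * f s) \<in> tree_space"
  by (rule tree_space_compose[where L = "norm c"]) (auto simp: norm_mult)

lemma tree_space_uminus: "f \<in> tree_space \<Longrightarrow> (\<lambda>s. - f s) \<in> tree_space"
  by (rule tree_space_compose[where L = 1]) auto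

lemma tree_space_diff:
  assumes "f \<in> tree_space" "g \<in> tree_space"
  shows "(\<lambda>s. f s - g s) \<in> tree_space"
  using tree_space_add[OF assms(1) tree_space_uminus[OF assms(2)]] by simp

lemma tree_space_sum: "(\<And>k. k \<in> I \<Longrightarrow> f k \<in> tree_space) \<Longrightarrow> (\<lambda>s. \<Sum>k\<in>I. f k s) \<in> tree_space"
  by (induction I rule: infinite_finite_induct) (auto intro!: tree_space_add tree_space_const)

lemma tree_space_norm: "f \<in> tree_space \<Longrightarrow> (\<lambda>s. norm (f s)) \<in> tree_space"
  by (rule tree_space_compose[where L = 1]) (auto intro: continuous_norm)

lemma tree_space_Re: "f \<in> tree_space \<Longrightarrow> (\<lambda>s. Re (f s)) \<in> tree_space"
  by (rule tree_space_compose[where L = 1]) (auto simp: abs_Re_le_cmod intro: continuous_intros)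

lemma tree_space_Im: "f \<in> tree_space \<Longrightarrow> (\<lambda>s. Im (f s)) \<in> tree_space"
  by (rule tree_space_compose[where L = 1]) (auto simp: abs_Im_le_cmod intro: continuous_intros)

lemma tree_space_of_real: "f \<in> tree_space \<Longrightarrow> (\<lambda>s. complex_of_real (f s)) \<in> tree_space"
  by (rule tree_space_compose[where L = 1]) (auto intro: continuous_intros)

lemma tree_space_Complex:
  assumes "f \<in> tree_space" "g \<in> tree_space"
  shows "(\<lambda>s. Complex (f s) (g s)) \<in> tree_space"
  using tree_space_add[OF tree_space_of_real[OF assms(1)]
      tree_space_mult[OF tree_space_of_real[OF assms(2)], of \<i>]]
  by (simp add: Complex_eq)

lemma tree_space_max:
  fixes f g :: "nat list \<Rightarrow> real"
  assumes "f \<in> tree_space" "g \<in> tree_space"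
  shows "(\<lambda>s. max (f s) (g s)) \<in> tree_space"
proof -
  have eq: "max a b = (1/2) * (a + b + norm (a - b))" for a b :: real by auto
  show ?thesis unfolding eq
    by (intro tree_space_mult tree_space_add tree_space_norm tree_space_diff assms)
qed

lemma tree_space_min:
  fixes f g :: "nat list \<Rightarrow> real"
  assumes "f \<in> tree_space" "g \<in> tree_space"
  shows "(\<lambda>s. min (f s) (g s)) \<in> tree_space"
proof -
  have eq: "min a b = - max (- a) (- b)" for a b :: real by auto
  show ?thesis unfolding eq by (intro tree_space_uminus tree_space_max assms)
qed

lemma tree_space_prefix:
  assumes "f \<in> tree_space"
  shows "(\<lambda>s. f (t @ s)) \<in> tree_space"
proof (rule tree_spaceI)
  show "norm (f (t @ s)) \<le> (tree_norm f * 2 ^ length t) * 2 ^ length s" for s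
    using norm_le_tree_norm[OF assms, of "t @ s"] by (simp add: power_add mult.assoc)
  show "(\<lambda>n. f (t @ s @ [n])) \<longlonglongrightarrow> f (t @ s)" for s
    using tree_space_limit[OF assms, of "t @ s"] by simp
qed

text \<open>
  Only finitely many children of a node outside the subtree rooted at \<open>t\<close> lie in that subtree, so
  a function on the subtree may be extended by zero.
\<close>

definition graft :: "nat list \<Rightarrow> (nat list \<Rightarrow> 'a::zero) \<Rightarrow> nat list \<Rightarrow> 'a" where
  "graft t f u = (if take (length t) u = t then f (drop (length t) u) else 0)"

lemma graft_append [simp]: "graft t f (t @ s) = f s"
  by (simp add: graft_def)

lemma graft_in_tree_space:
  assumes "f \<in> tree_space"
  shows "graft t f \<in> tree_space"
proof (rule tree_spaceI)
  show "norm (graft t f u) \<le> tree_norm f * 2 ^ length u" for u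
  proof (cases "take (length t) u = t")
    case True
    have "norm (f (drop (length t) u)) \<le> tree_norm f * 2 ^ length (drop (length t) u)"
      by (rule norm_le_tree_norm[OF assms])
    also have "\<dots> \<le> tree_norm f * 2 ^ length u"
      by (intro mult_left_mono power_increasing tree_norm_nonneg assms) auto
    finally show ?thesis using True by (simp add: graft_def)
  qed (simp add: graft_def tree_norm_nonneg[OF assms])
  show "(\<lambda>n. graft t f (u @ [n])) \<longlonglongrightarrow> graft t f u" for u
  proof (cases "length t \<le> length u")
    case True
    then show ?thesis using tree_space_limit[OF assms, of "drop (length t) u"]
      by (auto simp: graft_def)
  next
    case False
    have "graft t f (u @ [n]) = 0" if "n > last t" for n
    proof (rule ccontr)
      assume "graft t f (u @ [n]) \<noteq> 0"
      then have "take (length t) (u @ [n]) = t" by (auto simp: graft_def split: if_splits)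
      with False have "t = u @ [n]" by simp
      with that show False by simp
    qed
    moreover have "graft t f u = 0" using False by (auto simp: graft_def)
    ultimately show ?thesis
      by (intro tendsto_eventually) (auto intro: eventually_mono[OF eventually_gt_at_top[of "last t"]])
  qed
qed

text \<open>
  For each \<open>s\<close> the weights at \<open>s\<close> and at its children differ by the factor 2 only, so that
  convergence in norm is uniform on the children of \<open>s\<close>.
\<close>

lemma tree_space_closed:
  assumes approx: "\<And>e. 0 < e \<Longrightarrow> \<exists>g\<in>tree_space. \<forall>s. norm (g s - f s) \<le> e * 2 ^ length s"
  shows "f \<in> tree_space"
proof -
  obtain g where g: "g \<in> tree_space" "\<And>s. norm (g s - f s) \<le> 1 * 2 ^ length s"
    using approx[of 1] by auto
  show ?thesis
  proof (rule tree_spaceI)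
    show "norm (f s) \<le> (tree_norm g + 1) * 2 ^ length s" for s
      using norm_triangle_ineq4[of "g s" "g s - f s"] g(2)[of s] norm_le_tree_norm[OF g(1), of s]
      by (simp add: distrib_right)
    show "(\<lambda>n. f (s @ [n])) \<longlonglongrightarrow> f s" for s
    proof (rule LIMSEQ_I)
      fix r :: real assume "0 < r"
      \<comment> \<open>The bound at a child of \<open>s\<close> is twice the bound at \<open>s\<close>: the two errors add up to \<open>3 / 4\<close> of \<open>r\<close>.\<close>
      define e where "e = r / (4 * 2 ^ length s)"
      have e: "0 < e" "4 * (e * 2 ^ length s) = r"
        using \<open>0 < r\<close> by (simp_all add: e_def)
      obtain h where h: "h \<in> tree_space" "\<And>s. norm (h s - f s) \<le> e * 2 ^ length s"
        using approx[OF e(1)] by auto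
      obtain N where N: "\<And>n. n \<ge> N \<Longrightarrow> norm (h (s @ [n]) - h s) < r / 4"
        using LIMSEQ_D[OF tree_space_limit[OF h(1)], of "r/4" s] \<open>0 < r\<close> by auto
      have "norm (f (s @ [n]) - f s) < r" if "n \<ge> N" for n
      proof -
        have "f (s @ [n]) - f s = (h (s @ [n]) - h s) - (h (s @ [n]) - f (s @ [n])) + (h s - f s)"
          by simp
        then have "norm (f (s @ [n]) - f s) \<le> norm (h (s @ [n]) - h s)
            + norm (h (s @ [n]) - f (s @ [n])) + norm (h s - f s)"
          using norm_triangle_ineq norm_triangle_ineq4 by (smt (verit, ccfv_threshold))
        then show ?thesis using N[OF that] h(2)[of "s @ [n]"] h(2)[of s] e by simp
      qed
      then show "\<exists>N. \<forall>n\<ge>N. norm (f (s @ [n]) - f s) < r" by blast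
    qed
  qed
qed

text \<open>
  The first summand is composition with deletion of the first letter. The second one replaces the
  first letter \<open>n\<close> by the \<open>n\<close>-th word; it has no part at the empty word, so that \<open>f []\<close> is preserved
  for every choice of the weights \<open>v\<close>.
\<close>

fun walk :: "(nat \<Rightarrow> real) \<Rightarrow> (nat list \<Rightarrow> 'a::real_normed_vector) \<Rightarrow> nat list \<Rightarrow> 'a" where
  "walk v f [] = f []"
| "walk v f (n # s) = f s + v n *\<^sub>R f (list_decode n @ s)"

text \<open>
  The power of 2 makes up for the greater length of the point at which \<open>walk\<close> evaluates its
  argument. The factor \<open>1 / (n + 2)\<close> lets the second summand tend to 0 along the children of the
  empty word, which is continuity there, and is at most \<open>1 / 2\<close>, so that the summand has norm at
  most \<open>1 / 4\<close>.
\<close>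

definition jump_weight :: "nat \<Rightarrow> real" where
  "jump_weight n = 1 / ((real n + 2) * 2 ^ length (list_decode n))"

lemma jump_weight_pos: "0 < jump_weight n"
  by (simp add: jump_weight_def)

lemma norm_jump_le:
  assumes v: "\<bar>v n\<bar> \<le> jump_weight n" and f: "\<And>s. norm (f s) \<le> K * 2 ^ length s"
  shows "norm (v n *\<^sub>R f (list_decode n @ s)) \<le> K * 2 ^ length s / (real n + 2)"
proof -
  have "norm (v n *\<^sub>R f (list_decode n @ s))
      \<le> jump_weight n * (K * 2 ^ length (list_decode n @ s))"
    using mult_mono[OF v f[of "list_decode n @ s"]] jump_weight_pos[of n] by simp
  also have "\<dots> = K * 2 ^ length s / (real n + 2)"
    by (simp add: jump_weight_def power_add)
  finally show ?thesis .
qed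

text \<open>
  Deleting a letter halves the weight, which gives the bound \<open>1 / 2\<close> for the first summand of
  \<open>walk\<close>; the second one contributes at most \<open>1 / 4\<close>. Hence \<open>walk v\<close> is a contraction on the
  functions that vanish at the empty word.
\<close>

lemma norm_walk_le:
  assumes v: "\<And>n. \<bar>v n\<bar> \<le> jump_weight n" and f: "\<And>s. norm (f s) \<le> K * 2 ^ length s"
  shows "norm (walk v f (n # s)) \<le> 3 / 4 * K * 2 ^ length (n # s)"
proof -
  have "0 \<le> K" using f[of "[]"] norm_ge_zero[of "f []"] by (simp del: norm_ge_zero)
  then have half: "K * 2 ^ length s / (real n + 2) \<le> K * 2 ^ length s / 2"
    by (intro divide_left_mono) auto
  have "norm (walk v f (n # s)) \<le> norm (f s) + norm (v n *\<^sub>R f (list_decode n @ s))"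
    unfolding walk.simps by (rule norm_triangle_ineq)
  also have "\<dots> \<le> K * 2 ^ length s + K * 2 ^ length s / 2"
    by (intro add_mono f order_trans[OF norm_jump_le half] v)
  also have "\<dots> = 3 / 4 * K * 2 ^ length (n # s)" by simp
  finally show ?thesis .
qed

lemma walk_in_tree_space:
  assumes v: "\<And>n. \<bar>v n\<bar> \<le> jump_weight n" and f: "f \<in> tree_space"
  shows "walk v f \<in> tree_space"
proof (rule tree_spaceI)
  note le = norm_le_tree_norm[OF f]
  show "norm (walk v f s) \<le> tree_norm f * 2 ^ length s" for s
  proof (cases s)
    case Nil
    then show ?thesis using le[of "[]"] by simp
  next
    case (Cons n t)
    have "norm (walk v f s) \<le> 3 / 4 * (tree_norm f * 2 ^ length s)"
      using norm_walk_le[OF v le, of n t] Cons by simp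
    also have "\<dots> \<le> tree_norm f * 2 ^ length s" using tree_norm_nonneg[OF f] by simp
    finally show ?thesis .
  qed
  show "(\<lambda>n. walk v f (s @ [n])) \<longlonglongrightarrow> walk v f s" for s
  proof (cases s)
    case Nil
    have "(\<lambda>n. tree_norm f / (real n + 2)) \<longlonglongrightarrow> 0"
      by (rule real_tendsto_divide_at_top[OF tendsto_const])
        (intro filterlim_tendsto_add_at_top[OF tendsto_const] filterlim_real_sequentially
          | subst add.commute)+
    then have "(\<lambda>n. v n *\<^sub>R f (list_decode n @ [])) \<longlonglongrightarrow> 0"
      by (rule tendsto_0_le[where K = 1])
        (use norm_jump_le[of v _ f _ "[]", OF v le] tree_norm_nonneg[OF f]
          in \<open>auto simp del: append_Nil2\<close>)
    from tendsto_add[OF tendsto_const[of "f []"] this] show ?thesis using Nil by simp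
  next
    case (Cons n t)
    have "(\<lambda>m. f (t @ [m]) + v n *\<^sub>R f ((list_decode n @ t) @ [m]))
        \<longlonglongrightarrow> f t + v n *\<^sub>R f (list_decode n @ t)"
      by (intro tendsto_intros tree_space_limit f)
    then show ?thesis using Cons by simp
  qed
qed

section \<open>The resolvent of the operators on complex functions\<close>

lemma walk_add: "walk v (\<lambda>s. f s + g s) s = walk v f s + walk v g s"
  by (cases s) (auto simp: algebra_simps)

lemma walk_diff: "walk v (\<lambda>s. f s - g s) s = walk v f s - walk v g s"
  by (cases s) (auto simp: algebra_simps)

lemma walk_mult:
  fixes c :: "'a::real_normed_field"
  shows "walk v (\<lambda>s. c * f s) s = c * walk v f s"
  by (cases s) (auto simp: algebra_simps)

locale small_walk =
  fixes v :: "nat \<Rightarrow> real"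
  assumes small: "\<And>n. \<bar>v n\<bar> \<le> jump_weight n"
begin

definition null_space :: "(nat list \<Rightarrow> complex) set" where
  "null_space = {f \<in> tree_space. f [] = 0}"

lemma norm_walk_power_le:
  fixes f :: "nat list \<Rightarrow> complex"
  assumes "\<And>s. norm (f s) \<le> K * 2 ^ length s" and "f [] = 0"
  shows "(walk v ^^ k) f [] = 0 \<and> (\<forall>s. norm ((walk v ^^ k) f s) \<le> (3 / 4) ^ k * K * 2 ^ length s)"
proof (induction k)
  case (Suc k)
  define h where "h = (walk v ^^ k) f"
  have h: "h [] = 0" "\<And>s. norm (h s) \<le> ((3 / 4) ^ k * K) * 2 ^ length s"
    using Suc by (auto simp: h_def)
  have K: "0 \<le> K" using assms(1)[of "[]"] norm_ge_zero[of "f []"] by (simp del: norm_ge_zero)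
  have "norm (walk v h s) \<le> (3 / 4) ^ Suc k * K * 2 ^ length s" for s
  proof (cases s)
    case Nil
    then show ?thesis using h(1) K by simp
  next
    case (Cons n t)
    show ?thesis using norm_walk_le[of v h _ n t, OF small h(2)] Cons by (simp add: mult.assoc)
  qed
  then show ?case using h(1) by (simp add: h_def)
qed (use assms in auto)

text \<open>
  Two solutions of \<open>c h - walk v h = g\<close> with the same value at the empty word differ by an
  eigenfunction in the kernel of evaluation there, where \<open>walk v\<close> contracts by \<open>3 / 4\<close>. This
  uniqueness replaces most of the manipulations of series below: linearity, the left inverse
  property and the resolvent identity all follow from the fact that both sides solve the same
  equation.
\<close>

lemma shift_inj:
  fixes f g :: "nat list \<Rightarrow> complex"
  assumes "f \<in> tree_space" "g \<in> tree_space" "f [] = g []" "3 / 4 < norm c"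
    and eq: "\<And>s. c * f s - walk v f s = c * g s - walk v g s"
  shows "f = g"
proof -
  define h where "h = (\<lambda>s. f s - g s)"
  have h: "h \<in> tree_space" "h [] = 0"
    using assms by (auto simp: h_def intro: tree_space_diff)
  have "walk v h s = c * h s" for s
    using eq[of s] by (simp add: h_def walk_diff algebra_simps)
  then have "norm c * norm (h s) \<le> 3 / 4 * tree_norm h * 2 ^ length s" for s
    using norm_walk_power_le[of h "tree_norm h" 1, OF norm_le_tree_norm[OF h(1)] h(2)]
    by (simp add: norm_mult[symmetric])
  moreover have "0 < norm c" using assms(4) by linarith
  ultimately have "norm (h s) \<le> (3 / 4 * tree_norm h / norm c) * 2 ^ length s" for s
    by (auto simp: field_simps norm_mult)
  then have "tree_norm h \<le> 3 / 4 * tree_norm h / norm c"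
    by (rule tree_norm_le)
  then have "(norm c - 3 / 4) * tree_norm h \<le> 0"
    using \<open>0 < norm c\<close> by (simp add: pos_le_divide_eq algebra_simps)
  then have "tree_norm h \<le> 0" using assms(4) by (simp add: mult_le_0_iff)
  then have "norm (h s) \<le> 0" for s
    by (rule order_trans[OF norm_le_tree_norm[OF h(1)] mult_nonpos_nonneg]) auto
  then show ?thesis by (auto simp: h_def)
qed

text \<open>
  The Neumann series of the resolvent. It converges pointwise if \<open>3 / 4 < norm c\<close> and \<open>g\<close> vanishes at
  the empty word.
\<close>

definition neumann :: "complex \<Rightarrow> (nat list \<Rightarrow> complex) \<Rightarrow> nat list \<Rightarrow> complex" where
  "neumann c g s = (\<Sum>k. (walk v ^^ k) g s / c ^ Suc k)"

context
  fixes c :: complex and K :: real and g :: "nat list \<Rightarrow> complex"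
  assumes c: "3 / 4 < norm c"
    and g: "\<And>s. norm (g s) \<le> K * 2 ^ length s" "g [] = 0"
begin

lemma neumann_summable: "summable (\<lambda>k. (walk v ^^ k) g s / c ^ Suc k)"
  and norm_neumann_le: "norm (neumann c g s) \<le> K / (norm c - 3 / 4) * 2 ^ length s"
proof -
  define q where "q = 3 / 4 / norm c"
  have c0: "0 < norm c" using c by linarith
  have q: "0 \<le> q" "q < 1" using c c0 by (auto simp: q_def divide_less_eq)
  have le: "norm ((walk v ^^ k) g s / c ^ Suc k) \<le> K * 2 ^ length s / norm c * q ^ k" for k
  proof -
    have "norm ((walk v ^^ k) g s / c ^ Suc k) \<le> (3 / 4) ^ k * K * 2 ^ length s / norm c ^ Suc k"
      using norm_walk_power_le[OF g, of k] c0 by (auto simp: norm_divide norm_power norm_mult intro!: divide_right_mono)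
    also have "\<dots> = K * 2 ^ length s / norm c * q ^ k"
      by (simp add: q_def power_divide mult_ac)
    finally show ?thesis .
  qed
  have sums: "(\<lambda>k. K * 2 ^ length s / norm c * q ^ k) sums (K * 2 ^ length s / norm c * (1 / (1 - q)))"
    by (intro sums_mult geometric_sums) (use q in auto)
  show "summable (\<lambda>k. (walk v ^^ k) g s / c ^ Suc k)"
    by (rule summable_comparison_test'[OF sums_summable[OF sums] le])
  have "norm (neumann c g s) \<le> K * 2 ^ length s / norm c * (1 / (1 - q))"
    unfolding neumann_def using norm_suminf_le[OF le sums_summable[OF sums]] sums_unique[OF sums] by simp
  also have "\<dots> = K * 2 ^ length s * (1 / (norm c * (1 - q)))" by simp
  also have "norm c * (1 - q) = norm c - 3 / 4" using c0 by (simp add: q_def field_simps)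
  finally show "norm (neumann c g s) \<le> K / (norm c - 3 / 4) * 2 ^ length s" by simp
qed

text \<open>
  The value of \<open>walk v f\<close> at a point only involves two values of \<open>f\<close>, hence \<open>walk v\<close> may
  be applied to the series term by term.
\<close>

lemma walk_neumann: "walk v (neumann c g) s = (\<Sum>k. (walk v ^^ Suc k) g s / c ^ Suc k)"
proof (cases s)
  case Nil
  then show ?thesis by (simp add: neumann_def)
next
  case (Cons n t)
  have "walk v (neumann c g) s = (\<Sum>k. (walk v ^^ k) g t / c ^ Suc k
      + v n *\<^sub>R ((walk v ^^ k) g (list_decode n @ t) / c ^ Suc k))"
    using Cons suminf_add[OF neumann_summable summable_scaleR_right[OF neumann_summable]]
      suminf_scaleR_right[OF neumann_summable]
    by (simp add: neumann_def)
  also have "\<dots> = (\<Sum>k. (walk v ^^ Suc k) g s / c ^ Suc k)"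
    by (simp add: Cons add_divide_distrib scaleR_conv_of_real)
  finally show ?thesis .
qed

lemma neumann_equation: "c * neumann c g s - walk v (neumann c g) s = g s"
proof -
  have c0: "c \<noteq> 0" using c by auto
  have "c * neumann c g s = (\<Sum>k. c * ((walk v ^^ k) g s / c ^ Suc k))"
    unfolding neumann_def by (rule suminf_mult[OF neumann_summable, symmetric])
  also have "\<dots> = (\<Sum>k. (walk v ^^ k) g s / c ^ k)" using c0 by simp
  also have "\<dots> = (\<Sum>k. (walk v ^^ Suc k) g s / c ^ Suc k) + g s"
  proof -
    have "summable (\<lambda>k. (walk v ^^ k) g s / c ^ k)"
      using summable_mult[OF neumann_summable, of c s] c0 by simp
    from suminf_split_head[OF this] show ?thesis by simp
  qed
  finally show ?thesis by (simp add: walk_neumann)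
qed

lemma neumann_split:
  "neumann c g s - (\<Sum>k<m. (walk v ^^ k) g s / c ^ Suc k) = neumann c ((walk v ^^ m) g) s / c ^ m"
proof -
  have c0: "c \<noteq> 0" using c by auto
  have "neumann c g s = (\<Sum>k. (walk v ^^ (k + m)) g s / c ^ Suc (k + m)) + (\<Sum>k<m. (walk v ^^ k) g s / c ^ Suc k)"
    unfolding neumann_def by (rule suminf_split_initial_segment[OF neumann_summable])
  moreover have "(\<Sum>k. (walk v ^^ (k + m)) g s / c ^ Suc (k + m))
      = (\<Sum>k. (walk v ^^ k) ((walk v ^^ m) g) s / c ^ Suc k / c ^ m)"
    by (simp add: funpow_add power_add mult.assoc)
  moreover have "\<dots> = neumann c ((walk v ^^ m) g) s / c ^ m"
  proof -
    have "summable (\<lambda>k. (walk v ^^ k) ((walk v ^^ m) g) s / c ^ Suc k)"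
      using summable_mult[OF summable_ignore_initial_segment[OF neumann_summable[of s], of m], of "c ^ m"] c0
      by (simp add: funpow_add power_add)
    then show ?thesis unfolding neumann_def by (rule suminf_divide)
  qed
  ultimately show ?thesis by simp
qed

end

text \<open>
  Continuity of the sum comes from the remainder formula \<open>neumann_split\<close>, by which the partial
  sums converge in norm.
\<close>

lemma neumann_in_null_space:
  assumes c: "3 / 4 < norm c" and g: "g \<in> null_space"
  shows "neumann c g \<in> null_space"
proof -
  have g': "g \<in> tree_space" "g [] = 0" using g by (auto simp: null_space_def)
  note le = norm_le_tree_norm[OF g'(1)]
  have pow: "(walk v ^^ k) g \<in> tree_space" for k
    by (induction k) (auto intro: walk_in_tree_space small g')
  have "neumann c g \<in> tree_space"
  proof (rule tree_space_closed)
    fix e :: real assume "0 < e"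
    let ?b = "\<lambda>m. tree_norm g / (norm c - 3 / 4) * (3 / 4 / norm c) ^ m"
    have c0: "0 < norm c" using c by linarith
    have "?b \<longlonglongrightarrow> 0"
      using c c0 by (intro tendsto_mult_right_zero LIMSEQ_power_zero) (auto simp: divide_less_eq)
    from eventually_happens'[OF sequentially_bot order_tendstoD(2)[OF this \<open>0 < e\<close>]]
    obtain m where m: "?b m < e" by blast
    let ?p = "\<lambda>s. \<Sum>k<m. (walk v ^^ k) g s / c ^ Suc k"
    have "?p \<in> tree_space"
    proof (rule tree_space_sum)
      show "(\<lambda>s. (walk v ^^ k) g s / c ^ Suc k) \<in> tree_space" for k
        using tree_space_mult[OF pow, of "1 / c ^ Suc k" k] by simp
    qed
    moreover have "norm (?p s - neumann c g s) \<le> e * 2 ^ length s" for s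
    proof -
      have "norm (?p s - neumann c g s) = norm (neumann c ((walk v ^^ m) g) s) / norm c ^ m"
        unfolding norm_minus_commute[of "sum _ _"] neumann_split[OF c le g'(2)]
        by (simp add: norm_divide norm_power)
      also have "\<dots> \<le> ((3 / 4) ^ m * tree_norm g) / (norm c - 3 / 4) * 2 ^ length s / norm c ^ m"
        by (intro divide_right_mono norm_neumann_le[OF c]) (use norm_walk_power_le[OF le g'(2)] in auto)
      also have "\<dots> = ?b m * 2 ^ length s"
        by (simp add: power_divide field_simps)
      also have "\<dots> \<le> e * 2 ^ length s" using m by (intro mult_right_mono) auto
      finally show ?thesis .
    qed
    ultimately show "\<exists>h\<in>tree_space. \<forall>s. norm (h s - neumann c g s) \<le> e * 2 ^ length s"
      by (intro bexI[of _ ?p]) auto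
  qed
  moreover have "neumann c g [] = 0"
    using norm_walk_power_le[OF le g'(2)] by (simp add: neumann_def)
  ultimately show ?thesis by (simp add: null_space_def)
qed

lemma neumann_unique:
  assumes c: "3 / 4 < norm c" and "h \<in> null_space" "\<And>s. c * h s - walk v h s = g s"
  shows "neumann c g = h"
proof -
  have g_eq: "g = (\<lambda>s. c * h s - walk v h s)" using assms(3) by auto
  have h: "h \<in> tree_space" "h [] = 0" using assms(2) by (auto simp: null_space_def)
  have g: "g \<in> null_space"
    unfolding null_space_def g_eq using h by (auto intro!: tree_space_diff tree_space_mult walk_in_tree_space small)
  then have g': "g \<in> tree_space" "g [] = 0" by (auto simp: null_space_def)
  have n: "neumann c g \<in> tree_space" "neumann c g [] = 0"
    using neumann_in_null_space[OF c g] by (auto simp: null_space_def)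
  show ?thesis
    using neumann_equation[OF c norm_le_tree_norm[OF g'(1)] g'(2)] n h assms(3)
    by (intro shift_inj[OF _ _ _ c]) auto
qed

lemma neumann_equation':
  assumes "3 / 4 < norm c" "g \<in> null_space"
  shows "walk v (neumann c g) s = c * neumann c g s - g s"
  using neumann_equation[OF assms(1) norm_le_tree_norm, of g s] assms(2)
  by (auto simp: null_space_def algebra_simps)

lemma neumann_linear:
  assumes c: "3 / 4 < norm c" and "f \<in> null_space" "g \<in> null_space"
  shows "neumann c (\<lambda>s. f s + a * g s) = (\<lambda>s. neumann c f s + a * neumann c g s)"
  using neumann_in_null_space[OF c assms(2)] neumann_in_null_space[OF c assms(3)]
  by (intro neumann_unique[OF c])
    (auto simp: null_space_def walk_add walk_mult neumann_equation'[OF c assms(2)]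
      neumann_equation'[OF c assms(3)] algebra_simps intro!: tree_space_add tree_space_mult)

text \<open>
  The constant function 1 has value 1 at the empty word, and its defect \<open>walk v 1 - 1\<close> vanishes
  there. Hence it can be corrected by a Neumann series to an eigenvector for the eigenvalue 1.
\<close>

definition fixed_vector :: "nat list \<Rightarrow> complex" where
  "fixed_vector s = 1 + neumann 1 (\<lambda>s. walk v (\<lambda>_. 1) s - 1) s"

lemma fixed_vector: 
  "fixed_vector \<in> tree_space" "fixed_vector [] = 1" "walk v fixed_vector s = fixed_vector s"
proof -
  let ?g = "\<lambda>s. walk v (\<lambda>_. 1) s - 1 :: complex"
  have g: "?g \<in> null_space"
    by (auto simp: null_space_def intro!: tree_space_diff walk_in_tree_space small tree_space_const)
  have n: "neumann 1 ?g \<in> null_space" by (rule neumann_in_null_space[OF _ g]) simp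
  show "fixed_vector \<in> tree_space" "fixed_vector [] = 1"
    using n unfolding fixed_vector_def[abs_def] null_space_def
    by (auto intro: tree_space_add tree_space_const)
  have "walk v fixed_vector s = walk v (\<lambda>_. 1) s + walk v (neumann 1 ?g) s"
    unfolding fixed_vector_def[abs_def] by (rule walk_add)
  then show "walk v fixed_vector s = fixed_vector s"
    using neumann_equation'[OF _ g, of 1 s] by (simp add: fixed_vector_def)
qed

text \<open>
  The complement of the spectral projection \<open>g \<mapsto> g [] \<cdot> fixed_vector\<close>.
\<close>

definition deflate :: "(nat list \<Rightarrow> complex) \<Rightarrow> nat list \<Rightarrow> complex" where
  "deflate g s = g s - g [] * fixed_vector s"

lemma deflate_in_null_space: "g \<in> tree_space \<Longrightarrow> deflate g \<in> null_space"
  unfolding null_space_def deflate_def[abs_def]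
  by (auto intro!: tree_space_diff tree_space_mult fixed_vector simp: fixed_vector)

lemma norm_deflate_le:
  assumes g: "g \<in> tree_space"
  shows "norm (deflate g s) \<le> (1 + tree_norm fixed_vector) * tree_norm g * 2 ^ length s"
proof -
  have "norm (deflate g s) \<le> norm (g s) + norm (g []) * norm (fixed_vector s)"
    unfolding deflate_def using norm_triangle_ineq4[of "g s"] by (metis norm_mult)
  also have "\<dots> \<le> tree_norm g * 2 ^ length s + tree_norm g * (tree_norm fixed_vector * 2 ^ length s)"
    using norm_le_tree_norm[OF g, of "[]"]
    by (intro add_mono mult_mono norm_le_tree_norm g fixed_vector tree_norm_nonneg) auto
  finally show ?thesis by (simp add: algebra_simps)
qed

text \<open>
  The space is the direct sum of the line through \<open>fixed_vector\<close>, where \<open>c - walk v\<close> is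
  multiplication by \<open>c - 1\<close>, and of the kernel of evaluation at the empty word, where its inverse is
  the Neumann series.
\<close>

definition walk_resolvent :: "complex \<Rightarrow> (nat list \<Rightarrow> complex) \<Rightarrow> nat list \<Rightarrow> complex" where
  "walk_resolvent c g s = g [] / (c - 1) * fixed_vector s + neumann c (deflate g) s"

lemma
  fixes g :: "nat list \<Rightarrow> complex"
  assumes c: "3 / 4 < norm c" "c \<noteq> 1" and g: "g \<in> tree_space"
  shows walk_resolvent_in_tree_space: "walk_resolvent c g \<in> tree_space"
    and walk_resolvent_right: "c * walk_resolvent c g s - walk v (walk_resolvent c g) s = g s"
    and walk_resolvent_left: "walk_resolvent c (\<lambda>s. c * g s - walk v g s) = g"
proof -
  have mem: "walk_resolvent c g \<in> tree_space" if "g \<in> tree_space" for g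
    using neumann_in_null_space[OF c(1) deflate_in_null_space[OF that]]
    unfolding walk_resolvent_def[abs_def] null_space_def
    by (intro tree_space_add tree_space_mult fixed_vector(1)) simp
  have right: "c * walk_resolvent c g s - walk v (walk_resolvent c g) s = g s"
    if "g \<in> tree_space" for g s
  proof -
    define a where "a = g [] / (c - 1)"
    have a: "c * a = g [] + a" using c(2) by (simp add: a_def field_simps)
    have "walk v (walk_resolvent c g) s
        = a * fixed_vector s + (c * neumann c (deflate g) s - deflate g s)"
      unfolding walk_resolvent_def[abs_def] walk_add walk_mult a_def
      by (simp add: fixed_vector neumann_equation'[OF c(1) deflate_in_null_space[OF that]])
    then have "c * walk_resolvent c g s - walk v (walk_resolvent c g) s
        = (c * a) * fixed_vector s - a * fixed_vector s + deflate g s"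
      by (simp add: walk_resolvent_def a_def[symmetric] algebra_simps)
    then show ?thesis unfolding a by (simp add: deflate_def algebra_simps)
  qed
  show "walk_resolvent c g \<in> tree_space" and "c * walk_resolvent c g s - walk v (walk_resolvent c g) s = g s"
    using mem right g by auto
  let ?g = "\<lambda>s. c * g s - walk v g s"
  have g': "?g \<in> tree_space" by (intro tree_space_diff tree_space_mult walk_in_tree_space small g)
  have "walk_resolvent c ?g [] = g []"
  proof -
    have "(c - 1) * walk_resolvent c ?g [] = (c - 1) * g []"
      using right[OF g', of "[]"] by (simp add: left_diff_distrib)
    then show ?thesis using c(2) by simp
  qed
  then show "walk_resolvent c ?g = g"
    using right[OF g'] by (intro shift_inj[OF mem[OF g'] g _ c(1)]) auto
qed

lemma shift_inj_on:
  fixes f g :: "nat list \<Rightarrow> complex"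
  assumes c: "3 / 4 < norm c" "c \<noteq> 1" and "f \<in> tree_space" "g \<in> tree_space"
    and "\<And>s. c * f s - walk v f s = c * g s - walk v g s"
  shows "f = g"
proof -
  have "f = walk_resolvent c (\<lambda>s. c * f s - walk v f s)"
    by (rule walk_resolvent_left[OF c assms(3), symmetric])
  also have "(\<lambda>s. c * f s - walk v f s) = (\<lambda>s. c * g s - walk v g s)"
    by (rule ext) (rule assms(5))
  also have "walk_resolvent c \<dots> = g"
    by (rule walk_resolvent_left[OF c assms(4)])
  finally show ?thesis .
qed

lemma walk_resolvent_linear:
  assumes c: "3 / 4 < norm c" "c \<noteq> 1" and f: "f \<in> tree_space" and g: "g \<in> tree_space"
  shows "walk_resolvent c (\<lambda>s. f s + a * g s) = (\<lambda>s. walk_resolvent c f s + a * walk_resolvent c g s)"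
proof (rule shift_inj_on[OF c])
  show "walk_resolvent c (\<lambda>s. f s + a * g s) \<in> tree_space"
    "(\<lambda>s. walk_resolvent c f s + a * walk_resolvent c g s) \<in> tree_space"
    by (intro walk_resolvent_in_tree_space c tree_space_add tree_space_mult f g)+
  fix s
  have eqs: "walk v (walk_resolvent c f) s = c * walk_resolvent c f s - f s"
    "walk v (walk_resolvent c g) s = c * walk_resolvent c g s - g s"
    using walk_resolvent_right[OF c f, of s] walk_resolvent_right[OF c g, of s]
    by (auto simp: algebra_simps)
  have "c * walk_resolvent c (\<lambda>s. f s + a * g s) s - walk v (walk_resolvent c (\<lambda>s. f s + a * g s)) s
      = f s + a * g s"
    by (rule walk_resolvent_right[OF c tree_space_add[OF f tree_space_mult[OF g]]])
  also have "\<dots> = c * (walk_resolvent c f s + a * walk_resolvent c g s)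
      - (walk v (walk_resolvent c f) s + a * walk v (walk_resolvent c g) s)"
    unfolding eqs by (simp add: algebra_simps)
  also have "walk v (walk_resolvent c f) s + a * walk v (walk_resolvent c g) s
      = walk v (\<lambda>s. walk_resolvent c f s + a * walk_resolvent c g s) s"
    by (subst walk_add, subst walk_mult) (rule refl)
  finally show "c * walk_resolvent c (\<lambda>s. f s + a * g s) s - walk v (walk_resolvent c (\<lambda>s. f s + a * g s)) s
      = c * (walk_resolvent c f s + a * walk_resolvent c g s)
      - walk v (\<lambda>s. walk_resolvent c f s + a * walk_resolvent c g s) s"
    .
qed

lemma norm_walk_resolvent_le:
  assumes c: "3 / 4 < norm c" and g: "g \<in> tree_space"
  shows "norm (walk_resolvent c g s) \<le> (tree_norm fixed_vector / norm (c - 1)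
    + (1 + tree_norm fixed_vector) / (norm c - 3 / 4)) * tree_norm g * 2 ^ length s"
proof -
  have "norm (g [] / (c - 1) * fixed_vector s)
      \<le> tree_norm g / norm (c - 1) * (tree_norm fixed_vector * 2 ^ length s)"
    unfolding norm_mult norm_divide using norm_le_tree_norm[OF g, of "[]"] tree_norm_nonneg[OF g]
    by (intro mult_mono divide_right_mono norm_le_tree_norm fixed_vector) auto
  moreover have "norm (neumann c (deflate g) s)
      \<le> (1 + tree_norm fixed_vector) * tree_norm g / (norm c - 3 / 4) * 2 ^ length s"
    using deflate_in_null_space[OF g]
    by (intro norm_neumann_le c norm_deflate_le g) (simp add: null_space_def)
  ultimately have "norm (walk_resolvent c g s)
      \<le> tree_norm g / norm (c - 1) * (tree_norm fixed_vector * 2 ^ length s)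
        + (1 + tree_norm fixed_vector) * tree_norm g / (norm c - 3 / 4) * 2 ^ length s"
    unfolding walk_resolvent_def by (rule norm_triangle_mono)
  also have "\<dots> = (tree_norm fixed_vector / norm (c - 1)
    + (1 + tree_norm fixed_vector) / (norm c - 3 / 4)) * tree_norm g * 2 ^ length s"
    by (simp add: distrib_right)
  finally show ?thesis .
qed

text \<open>
  On the kernel of evaluation at the empty word \<open>S = neumann 1\<close> inverts \<open>1 - walk v\<close>, so that
  the inverse of \<open>c - walk v = (1 - walk v) + (c - 1)\<close> has the expansion
  \<open>\<Sum>j. (- (c - 1)) ^ j S ^ (j + 1)\<close> there. The coefficient with number 0 is the residue.
\<close>

definition laurent_coeff :: "nat \<Rightarrow> (nat list \<Rightarrow> complex) \<Rightarrow> nat list \<Rightarrow> complex" where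
  "laurent_coeff k g s = (case k of 0 \<Rightarrow> g [] * fixed_vector s
     | Suc j \<Rightarrow> (-1) ^ j * (neumann 1 ^^ Suc j) (deflate g) s)"

lemma neumann_power:
  assumes "g \<in> null_space" and "\<And>s. norm (g s) \<le> K * 2 ^ length s"
  shows "(neumann 1 ^^ k) g \<in> null_space \<and> (\<forall>s. norm ((neumann 1 ^^ k) g s) \<le> 4 ^ k * K * 2 ^ length s)"
proof (induction k)
  case (Suc k)
  have "norm (neumann 1 ((neumann 1 ^^ k) g) s) \<le> (4 ^ k * K) / (norm (1 :: complex) - 3 / 4) * 2 ^ length s" for s
    by (rule norm_neumann_le) (use Suc in \<open>auto simp: null_space_def\<close>)
  then show ?case using neumann_in_null_space[of 1 "(neumann 1 ^^ k) g"] Suc by (simp add: mult_ac)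
qed (use assms in auto)

lemma neumann_power_linear:
  assumes "f \<in> null_space" "g \<in> null_space"
  shows "(neumann 1 ^^ k) (\<lambda>s. f s + a * g s) = (\<lambda>s. (neumann 1 ^^ k) f s + a * (neumann 1 ^^ k) g s)"
proof (induction k)
  case (Suc k)
  have "(neumann 1 ^^ k) f \<in> null_space" "(neumann 1 ^^ k) g \<in> null_space"
    using neumann_power[OF _ norm_le_tree_norm] assms by (auto simp: null_space_def)
  then show ?case by (simp add: Suc neumann_linear)
qed simp

lemma neumann_resolvent_identity:
  assumes c: "3 / 4 < norm c" and g: "g \<in> null_space"
  shows "neumann c g = (\<lambda>s. neumann 1 g s - (c - 1) * neumann 1 (neumann c g) s)"
proof -
  have n: "neumann c g \<in> null_space" by (rule neumann_in_null_space[OF c g])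
  have "neumann 1 (\<lambda>s. g s + (1 - c) * neumann c g s) = neumann c g"
    by (rule neumann_unique[OF _ n]) (auto simp: neumann_equation'[OF c g] algebra_simps)
  then show ?thesis using neumann_linear[OF _ g n, of 1 "1 - c"] by (simp add: algebra_simps)
qed

lemma neumann_power_resolvent_identity:
  assumes c: "3 / 4 < norm c" and g: "g \<in> null_space"
  shows "(neumann 1 ^^ n) (neumann c g)
    = (\<lambda>s. (neumann 1 ^^ Suc n) g s + (1 - c) * (neumann 1 ^^ Suc n) (neumann c g) s)"
proof -
  have n: "neumann 1 g \<in> null_space" "neumann 1 (neumann c g) \<in> null_space"
    by (auto intro!: neumann_in_null_space c g)
  have "(neumann 1 ^^ n) (neumann c g)
      = (neumann 1 ^^ n) (\<lambda>s. neumann 1 g s + (1 - c) * neumann 1 (neumann c g) s)"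
    by (subst neumann_resolvent_identity[OF c g]) (simp add: algebra_simps)
  then show ?thesis
    unfolding neumann_power_linear[OF n] funpow_Suc_right by simp
qed

text \<open>
  Iterating \<open>N = S + (1 - c) S N\<close>, where \<open>N = neumann c\<close> and \<open>S = neumann 1\<close>, turns the remainder of
  the Laurent series into a single term.
\<close>

lemma laurent_remainder:
  assumes c: "3 / 4 < norm c" "c \<noteq> 1" and g: "g \<in> tree_space"
  shows "walk_resolvent c g s - (\<Sum>k<Suc n. (c - 1) powi (int k - 1) * laurent_coeff k g s)
    = (1 - c) ^ n * (neumann 1 ^^ n) (neumann c (deflate g)) s"
proof (induction n)
  case 0
  show ?case by (simp add: walk_resolvent_def laurent_coeff_def power_int_minus field_simps)
next
  case (Suc n)
  have term_eq: "(c - 1) powi (int (Suc n) - 1) * laurent_coeff (Suc n) g s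
      = (1 - c) ^ n * (neumann 1 ^^ Suc n) (deflate g) s"
    using power_mult_distrib[of "c - 1" "-1" n]
    by (simp add: laurent_coeff_def del: funpow.simps)
  have "(1 - c) ^ n * (neumann 1 ^^ n) (neumann c (deflate g)) s
      = (1 - c) ^ n * (neumann 1 ^^ Suc n) (deflate g) s
        + (1 - c) ^ Suc n * (neumann 1 ^^ Suc n) (neumann c (deflate g)) s"
    by (subst neumann_power_resolvent_identity[OF c(1) deflate_in_null_space[OF g]])
      (simp add: distrib_left mult_ac del: funpow.simps)
  with Suc show ?case
    unfolding sum.lessThan_Suc[of _ "Suc n"] term_eq diff_diff_eq[symmetric] by simp
qed

lemma norm_laurent_remainder_le:
  assumes c: "3 / 4 < norm c" "c \<noteq> 1" and g: "g \<in> tree_space"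
  shows "norm (walk_resolvent c g s - (\<Sum>k<Suc n. (c - 1) powi (int k - 1) * laurent_coeff k g s))
    \<le> (4 * norm (c - 1)) ^ n * ((1 + tree_norm fixed_vector) / (norm c - 3 / 4)) * tree_norm g * 2 ^ length s"
proof -
  note d = deflate_in_null_space[OF g]
  have "norm ((neumann 1 ^^ n) (neumann c (deflate g)) s)
      \<le> 4 ^ n * ((1 + tree_norm fixed_vector) * tree_norm g / (norm c - 3 / 4)) * 2 ^ length s"
    using neumann_power[OF neumann_in_null_space[OF c(1) d] norm_neumann_le[OF c(1) norm_deflate_le[OF g]], of n]
      d by (auto simp: null_space_def)
  from mult_left_mono[OF this, of "norm (c - 1) ^ n"] show ?thesis
    unfolding laurent_remainder[OF c g]
    by (simp add: norm_mult norm_power norm_minus_commute power_mult_distrib mult_ac)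
qed

lemma laurent_coeff_in_tree_space: "g \<in> tree_space \<Longrightarrow> laurent_coeff k g \<in> tree_space"
  using neumann_power[OF deflate_in_null_space norm_deflate_le, of g]
  by (cases k) (auto simp: laurent_coeff_def[abs_def] null_space_def simp del: funpow.simps
      intro!: tree_space_mult fixed_vector)

lemma deflate_linear: "deflate (\<lambda>s. f s + a * g s) = (\<lambda>s. deflate f s + a * deflate g s)"
  by (auto simp: deflate_def algebra_simps)

lemma laurent_coeff_linear:
  assumes "f \<in> tree_space" "g \<in> tree_space"
  shows "laurent_coeff k (\<lambda>s. f s + a * g s) = (\<lambda>s. laurent_coeff k f s + a * laurent_coeff k g s)"
proof (cases k)
  case (Suc j)
  have "(neumann 1 ^^ Suc j) (deflate (\<lambda>s. f s + a * g s))
      = (\<lambda>s. (neumann 1 ^^ Suc j) (deflate f) s + a * (neumann 1 ^^ Suc j) (deflate g) s)"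
    unfolding deflate_linear by (intro neumann_power_linear deflate_in_null_space assms)
  then show ?thesis by (simp add: laurent_coeff_def[abs_def] Suc algebra_simps del: funpow.simps)
qed (simp add: laurent_coeff_def[abs_def] algebra_simps)

lemma norm_laurent_coeff_le:
  assumes "g \<in> tree_space"
  shows "norm (laurent_coeff k g s) \<le> 4 ^ k * (1 + tree_norm fixed_vector) * tree_norm g * 2 ^ length s"
proof (cases k)
  case 0
  have "norm (laurent_coeff k g s) \<le> tree_norm g * (tree_norm fixed_vector * 2 ^ length s)"
    using 0 norm_le_tree_norm[OF assms, of "[]"]
    by (auto simp: laurent_coeff_def norm_mult intro!: mult_mono norm_le_tree_norm tree_norm_nonneg assms fixed_vector)
  also have "\<dots> \<le> (1 + tree_norm fixed_vector) * tree_norm g * 2 ^ length s"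
    using tree_norm_nonneg[OF assms] by (simp add: algebra_simps)
  finally show ?thesis using 0 by simp
next
  case (Suc j)
  then show ?thesis
    using neumann_power[OF deflate_in_null_space norm_deflate_le, OF assms assms, of k]
    by (auto simp: laurent_coeff_def norm_mult norm_power mult.assoc simp del: funpow.simps)
qed

end

section \<open>The Banach lattice\<close>

text \<open>
  Words are labels for the points of \<open>nat \<Rightarrow> real\<close>: a function on words is carried over by composing
  it with a surjection \<open>label\<close>. The only reason is the type over which the Banach lattice is asserted
  to exist.
\<close>

definition code :: "nat list \<Rightarrow> nat \<Rightarrow> real" where
  "code s = (\<lambda>_. real (list_encode s))"

definition label :: "(nat \<Rightarrow> real) \<Rightarrow> nat list" where
  "label = inv_into UNIV code"

definition spread :: "(nat list \<Rightarrow> 'a) \<Rightarrow> (nat \<Rightarrow> real) \<Rightarrow> 'a" where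
  "spread f w = f (label w)"

lemma label_code [simp]: "label (code s) = s"
proof -
  have "inj code" by (rule injI) (simp add: code_def fun_eq_iff list_encode_eq)
  then show ?thesis by (simp add: label_def)
qed

lemma spread_code [simp]: "spread f (code s) = f s"
  by (simp add: spread_def)

lemma spread_comp_code [simp]: "spread f \<circ> code = f"
  by auto

lemma spread_eq_iff [simp]: "spread f = spread g \<longleftrightarrow> f = g"
  by (metis spread_comp_code)

definition tree_lattice :: "((nat \<Rightarrow> real) \<Rightarrow> real) normed_lattice" where
  "tree_lattice =
     \<lparr>carrier = spread ` tree_space,
      monoid.mult = undefined,
      one = undefined,
      zero = spread (\<lambda>_. 0),
      add = (\<lambda>F G w. F w + G w),
      smult = (\<lambda>c F w. c * F w),
      vnorm = (\<lambda>F. tree_norm (F \<circ> code)),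
      vle = (\<le>)\<rparr>"

abbreviation complex_lattice where
  "complex_lattice \<equiv> complexification tree_lattice"

lemma tree_lattice_simps [simp]:
  "carrier tree_lattice = spread ` tree_space"
  "\<zero>\<^bsub>tree_lattice\<^esub> = spread (\<lambda>_. 0)"
  "spread f \<oplus>\<^bsub>tree_lattice\<^esub> spread g = spread (\<lambda>s. f s + g s)"
  "c \<odot>\<^bsub>tree_lattice\<^esub> spread f = spread (\<lambda>s. c * f s)"
  "vnorm tree_lattice (spread f) = tree_norm f"
  by (auto simp: tree_lattice_def spread_def)

lemma vle_spread [simp]: "vle tree_lattice (spread f) (spread g) \<longleftrightarrow> f \<le> g"
  by (simp add: tree_lattice_def le_fun_def) (metis spread_code spread_def)

lemma abelian_group_tree_lattice: "abelian_group tree_lattice"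
proof (rule abelian_groupI)
  fix x assume "x \<in> carrier tree_lattice"
  then obtain f where f: "x = spread f" "f \<in> tree_space" by auto
  show "\<exists>y\<in>carrier tree_lattice. y \<oplus>\<^bsub>tree_lattice\<^esub> x = \<zero>\<^bsub>tree_lattice\<^esub>"
    by (rule bexI[of _ "spread (\<lambda>s. - f s)"]) (auto simp: f intro!: imageI tree_space_uminus)
qed (auto simp: algebra_simps intro!: tree_space_add tree_space_const)

lemma module_tree_lattice: "Module.module scalar_ring tree_lattice"
  by (rule moduleI[OF cring_scalar_ring abelian_group_tree_lattice])
    (auto simp: scalar_ring_def algebra_simps intro!: tree_space_mult)

lemma uminus_spread [simp]:
  assumes "f \<in> tree_space"
  shows "\<ominus>\<^bsub>tree_lattice\<^esub> spread f = spread (\<lambda>s. - f s)"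
proof -
  interpret abelian_group tree_lattice by (rule abelian_group_tree_lattice)
  show ?thesis by (rule minus_equality) (use assms in \<open>auto intro: tree_space_uminus\<close>)
qed

lemma diff_spread [simp]:
  "f \<in> tree_space \<Longrightarrow> g \<in> tree_space \<Longrightarrow>
    spread f \<ominus>\<^bsub>tree_lattice\<^esub> spread g = spread (\<lambda>s. f s - g s)"
  by (simp add: a_minus_def)

lemma is_supremum_spread:
  "is_supremum tree_lattice (spread ` D) (spread u) \<longleftrightarrow>
    u \<in> tree_space \<and> (\<forall>d\<in>D. d \<le> u) \<and> (\<forall>w\<in>tree_space. (\<forall>d\<in>D. d \<le> w) \<longrightarrow> u \<le> w)"
  by (auto simp: is_supremum_def)

lemma is_infimum_spread:
  "is_infimum tree_lattice (spread ` D) (spread u) \<longleftrightarrow>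
    u \<in> tree_space \<and> (\<forall>d\<in>D. u \<le> d) \<and> (\<forall>w\<in>tree_space. (\<forall>d\<in>D. w \<le> d) \<longrightarrow> w \<le> u)"
  by (auto simp: is_infimum_def)

lemma is_supremum_unique:
  assumes "is_supremum tree_lattice S u" "is_supremum tree_lattice S w"
  shows "u = w"
proof -
  from assms obtain f g where fg: "u = spread f" "w = spread g"
    unfolding is_supremum_def by auto
  from assms have "vle tree_lattice u w" "vle tree_lattice w u"
    unfolding is_supremum_def by blast+
  then show ?thesis by (simp add: fg)
qed

lemma modulus_spread [simp]:
  assumes "f \<in> tree_space"
  shows "modulus tree_lattice (spread f) = spread (\<lambda>s. \<bar>f s\<bar>)"
proof -
  have "is_supremum tree_lattice (spread ` {f, \<lambda>s. - f s}) (spread (\<lambda>s. \<bar>f s\<bar>))"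
    unfolding is_supremum_spread using tree_space_norm[OF assms]
    by (auto simp: le_fun_def abs_le_iff)
  then have "is_supremum tree_lattice {spread f, \<ominus>\<^bsub>tree_lattice\<^esub> spread f} (spread (\<lambda>s. \<bar>f s\<bar>))"
    using assms by simp
  then show ?thesis unfolding modulus_def by (blast intro: is_supremum_unique)
qed

lemma tree_norm_mono:
  fixes f g :: "nat list \<Rightarrow> real"
  assumes "g \<in> tree_space" "\<And>s. \<bar>f s\<bar> \<le> \<bar>g s\<bar>"
  shows "tree_norm f \<le> tree_norm g"
  using norm_le_tree_norm[OF assms(1)] order_trans[OF assms(2)] by (intro tree_norm_le) auto

lemma norm_on_tree_lattice: "norm_on tree_lattice (vnorm tree_lattice)"
  unfolding norm_on_def seminorm_on_def
proof (intro conjI ballI allI impI)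
  fix x assume "x \<in> carrier tree_lattice"
  then obtain f where x: "x = spread f" and f: "f \<in> tree_space" by auto
  note le = norm_le_tree_norm[OF f]
  show "0 \<le> vnorm tree_lattice x" by (simp add: x tree_norm_nonneg f)
  have mult: "tree_norm (\<lambda>s. c * g s) \<le> norm c * tree_norm g"
    if "g \<in> tree_space" for c and g :: "nat list \<Rightarrow> real"
    using mult_left_mono[OF norm_le_tree_norm[OF that], of "norm c"]
    by (intro tree_norm_le) (auto simp: abs_mult mult.assoc)
  show "vnorm tree_lattice (c \<odot>\<^bsub>tree_lattice\<^esub> x) = norm c * vnorm tree_lattice x" for c
  proof (cases "c = 0")
    case True
    then show ?thesis using tree_norm_le[of "\<lambda>_. 0 :: real" 0] tree_norm_nonneg[OF tree_space_const[of "0 :: real"]]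
      by (simp add: x)
  next
    case False
    then have "tree_norm f \<le> norm (1 / c) * tree_norm (\<lambda>s. c * f s)"
      using mult[OF tree_space_mult[OF f, of c], of "1 / c"] by simp
    then have "norm c * tree_norm f \<le> tree_norm (\<lambda>s. c * f s)"
      using False by (simp add: field_simps)
    then show ?thesis using mult[OF f, of c] by (simp add: x)
  qed
  fix y assume "y \<in> carrier tree_lattice"
  then obtain g where y: "y = spread g" and g: "g \<in> tree_space" by auto
  have "tree_norm (\<lambda>s. f s + g s) \<le> tree_norm f + tree_norm g"
    using norm_triangle_mono[OF le norm_le_tree_norm[OF g]]
    by (intro tree_norm_le) (auto simp: distrib_right)
  then show "vnorm tree_lattice (x \<oplus>\<^bsub>tree_lattice\<^esub> y) \<le> vnorm tree_lattice x + vnorm tree_lattice y"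
    by (simp add: x y)
next
  fix x assume "x \<in> carrier tree_lattice" and 0: "vnorm tree_lattice x = 0"
  then obtain f where x: "x = spread f" and f: "f \<in> tree_space" by auto
  have "f = (\<lambda>_. 0)" using norm_le_tree_norm[OF f] 0 by (auto simp: x)
  then show "x = \<zero>\<^bsub>tree_lattice\<^esub>" by (simp add: x)
qed

lemma norm_complete_tree_lattice: "norm_complete tree_lattice"
  unfolding norm_complete_def
proof (intro allI impI)
  fix x :: "nat \<Rightarrow> (nat \<Rightarrow> real) \<Rightarrow> real"
  assume x: "(\<forall>n. x n \<in> carrier tree_lattice) \<and>
    (\<forall>e>0. \<exists>N. \<forall>m\<ge>N. \<forall>n\<ge>N. vnorm tree_lattice (x m \<ominus>\<^bsub>tree_lattice\<^esub> x n) < e)"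
  define f where "f n = x n \<circ> code" for n
  have f: "f n \<in> tree_space" and x_eq: "x n = spread (f n)" for n
    using x by (auto simp: f_def image_iff) (metis spread_comp_code)+
  have cauchy: "\<exists>N. \<forall>m\<ge>N. \<forall>n\<ge>N. \<forall>s. \<bar>f m s - f n s\<bar> \<le> e * 2 ^ length s" if e: "0 < e" for e
  proof -
    obtain N where "\<forall>m\<ge>N. \<forall>n\<ge>N. tree_norm (\<lambda>s. f m s - f n s) < e"
      using x e by (auto simp: x_eq f)
    moreover have "\<bar>f m s - f n s\<bar> \<le> tree_norm (\<lambda>s. f m s - f n s) * 2 ^ length s" for m n s
      using norm_le_tree_norm[OF tree_space_diff[OF f f]] by simp
    ultimately show ?thesis
      by (intro exI[of _ N]) (meson order_trans mult_right_mono less_imp_le zero_le_numeral zero_le_power)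
  qed
  have conv: "convergent (\<lambda>n. f n s)" for s
    unfolding Cauchy_convergent_iff[symmetric]
  proof (rule CauchyI)
    fix e :: real assume "0 < e"
    then have "0 < e / 2 / 2 ^ length s" by simp
    from cauchy[OF this] obtain N
      where "\<forall>m\<ge>N. \<forall>n\<ge>N. \<bar>f m s - f n s\<bar> \<le> e / 2 / 2 ^ length s * 2 ^ length s"
      by blast
    then have "\<forall>m\<ge>N. \<forall>n\<ge>N. \<bar>f m s - f n s\<bar> \<le> e / 2" by simp
    then show "\<exists>M. \<forall>m\<ge>M. \<forall>n\<ge>M. norm (f m s - f n s) < e"
      using \<open>0 < e\<close> by (intro exI[of _ N]) fastforce
  qed
  define l where "l s = lim (\<lambda>n. f n s)" for s
  have lim: "(\<lambda>n. f n s) \<longlonglongrightarrow> l s" for s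
    unfolding l_def using conv by (simp add: convergent_LIMSEQ_iff)
  \<comment> \<open>The limit is uniform in \<open>s\<close> relative to the weights, as \<open>N\<close> does not depend on \<open>s\<close>.\<close>
  have close: "\<exists>N. \<forall>m\<ge>N. \<forall>s. \<bar>f m s - l s\<bar> \<le> e * 2 ^ length s" if e: "0 < e" for e
  proof -
    obtain N where N: "\<forall>m\<ge>N. \<forall>n\<ge>N. \<forall>s. \<bar>f m s - f n s\<bar> \<le> e * 2 ^ length s"
      using cauchy[OF e] by blast
    have "\<bar>f m s - l s\<bar> \<le> e * 2 ^ length s" if "m \<ge> N" for m s
      by (rule LIMSEQ_le_const2[OF tendsto_rabs[OF tendsto_diff[OF tendsto_const lim]]])
        (use N that in blast)
    then show ?thesis by blast
  qed
  have l: "l \<in> tree_space"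
  proof (rule tree_space_closed)
    fix e :: real assume "0 < e"
    from close[OF this] f show "\<exists>g\<in>tree_space. \<forall>s. norm (g s - l s) \<le> e * 2 ^ length s"
      by fastforce
  qed
  have "(\<lambda>n. tree_norm (\<lambda>s. f n s - l s)) \<longlonglongrightarrow> 0"
  proof (rule LIMSEQ_I)
    fix e :: real assume "0 < e"
    then obtain N where N: "\<forall>m\<ge>N. \<forall>s. \<bar>f m s - l s\<bar> \<le> e / 2 * 2 ^ length s"
      using close[of "e / 2"] half_gt_zero by blast
    have "tree_norm (\<lambda>s. f m s - l s) \<le> e / 2" if "m \<ge> N" for m
      by (rule tree_norm_le) (use N that in \<open>simp only: real_norm_def\<close>)
    then show "\<exists>N. \<forall>n\<ge>N. norm (tree_norm (\<lambda>s. f n s - l s) - 0) < e"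
      using \<open>0 < e\<close> tree_norm_nonneg[OF tree_space_diff[OF f l]]
      by (intro exI[of _ N]) force
  qed
  then show "\<exists>l\<in>carrier tree_lattice. (\<lambda>n. vnorm tree_lattice (x n \<ominus>\<^bsub>tree_lattice\<^esub> l)) \<longlonglongrightarrow> 0"
    using l by (intro bexI[of _ "spread l"]) (auto simp: x_eq f)
qed

lemma banach_lattice_tree_lattice: "banach_lattice tree_lattice"
proof (intro banach_lattice.intro banach_lattice_axioms.intro)
  show "reflp_on (carrier tree_lattice) (vle tree_lattice)"
    "antisymp_on (carrier tree_lattice) (vle tree_lattice)"
    "transp_on (carrier tree_lattice) (vle tree_lattice)"
    by (auto simp: reflp_on_def antisymp_on_def transp_on_def)
next
  fix x y assume "x \<in> carrier tree_lattice" "y \<in> carrier tree_lattice"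
  then obtain f g where fg: "x = spread f" "y = spread g" "f \<in> tree_space" "g \<in> tree_space" by auto
  show "\<exists>u. is_supremum tree_lattice {x, y} u"
    using is_supremum_spread[of "{f, g}" "\<lambda>s. max (f s) (g s)"] tree_space_max[OF fg(3,4)]
    by (auto simp: fg le_fun_def)
  show "\<exists>u. is_infimum tree_lattice {x, y} u"
    using is_infimum_spread[of "{f, g}" "\<lambda>s. min (f s) (g s)"] tree_space_min[OF fg(3,4)]
    by (auto simp: fg le_fun_def)
qed (auto simp: module_tree_lattice norm_on_tree_lattice norm_complete_tree_lattice le_fun_def
    intro!: mult_left_mono tree_norm_mono)

section \<open>The Lorentz seminorm\<close>

definition lift :: "((nat list \<Rightarrow> real) \<Rightarrow> nat list \<Rightarrow> real)
    \<Rightarrow> ((nat \<Rightarrow> real) \<Rightarrow> real) \<Rightarrow> (nat \<Rightarrow> real) \<Rightarrow> real" where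
  "lift T F = spread (T (F \<circ> code))"

lemma lift_spread [simp]: "lift T (spread f) = spread (T f)"
  by (simp add: lift_def)

text \<open>
  The value at a word is the limit of the values at its children. Order relations may therefore be
  checked on frequently many children; this is what makes suprema differ from pointwise suprema.
\<close>

lemma le_by_children:
  fixes f g :: "nat list \<Rightarrow> real"
  assumes "f \<in> tree_space" "g \<in> tree_space" "\<exists>\<^sub>F n in sequentially. f (s @ [n]) \<le> g (s @ [n])"
  shows "f s \<le> g s"
proof (rule ccontr)
  assume "\<not> f s \<le> g s"
  have "(\<lambda>n. g (s @ [n]) - f (s @ [n])) \<longlonglongrightarrow> g s - f s"
    by (intro tendsto_diff tree_space_limit assms)
  then have "\<forall>\<^sub>F n in sequentially. g (s @ [n]) - f (s @ [n]) < 0"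
    by (rule order_tendstoD) (use \<open>\<not> f s \<le> g s\<close> in simp)
  then have "\<forall>\<^sub>F n in sequentially. \<not> f (s @ [n]) \<le> g (s @ [n])"
    by (rule eventually_mono) simp
  with assms(3) show False by (simp add: frequently_def)
qed

text \<open>
  The words of length less than \<open>k\<close> form a nowhere dense set.
\<close>

lemma le_by_deep_nodes:
  fixes f g :: "nat list \<Rightarrow> real"
  assumes fg: "f \<in> tree_space" "g \<in> tree_space" and deep: "\<And>s. k \<le> length s \<Longrightarrow> f s \<le> g s"
  shows "f \<le> g"
proof (rule le_funI)
  show "f s \<le> g s" for s
  proof (induction "k - length s" arbitrary: s)
    case 0
    then show ?case by (intro deep) simp
  next
    case (Suc j)
    then have "f (s @ [n]) \<le> g (s @ [n])" for n by (intro Suc(1)) simp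
    then show ?case by (intro le_by_children fg) simp
  qed
qed

text \<open>
  For each \<open>k\<close> these functions vanish at all words of length at most \<open>k\<close>, which keeps their norms at or
  below \<open>1 / 2 ^ Suc k\<close>. Restricting the letter at position \<open>k\<close> makes them continuous at the words of
  length \<open>k\<close>, and as the bound \<open>n\<close> grows they increase to 1 at all longer words.
\<close>

definition deep_part :: "nat \<Rightarrow> nat \<Rightarrow> nat list \<Rightarrow> real" where
  "deep_part k n s = (if k < length s \<and> s ! k \<le> n then 1 else 0)"

lemma deep_part_in_tree_space: "deep_part k n \<in> tree_space"
proof (rule tree_spaceI[where K = 1])
  show "norm (deep_part k n s) \<le> 1 * 2 ^ length s" for s
    by (simp add: deep_part_def)
  show "(\<lambda>m. deep_part k n (s @ [m])) \<longlonglongrightarrow> deep_part k n s" for s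
  proof (rule tendsto_eventually, rule eventually_mono[OF eventually_gt_at_top[of n]])
    show "deep_part k n (s @ [m]) = deep_part k n s" if "n < m" for m
      using that by (auto simp: deep_part_def nth_append)
  qed
qed

lemma tree_norm_deep_part: "tree_norm (deep_part k n) \<le> 1 / 2 ^ Suc k"
proof (rule tree_norm_le)
  show "norm (deep_part k n s) \<le> 1 / 2 ^ Suc k * 2 ^ length s" for s
    using power_increasing[of "Suc k" "length s" "2 :: real"]
    by (auto simp: deep_part_def field_simps)
qed

lemma is_supremum_deep_part:
  "is_supremum tree_lattice (range (\<lambda>n. spread (deep_part k n))) (spread (\<lambda>_. 1))"
proof -
  have "(\<lambda>_. 1) \<le> w" if w: "w \<in> tree_space" "\<forall>n. deep_part k n \<le> w" for w
  proof (rule le_by_deep_nodes[OF tree_space_const w(1), of "Suc k"])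
    fix s :: "nat list" assume "Suc k \<le> length s"
    then show "1 \<le> w s"
      using w(2)[rule_format, of "s ! k"] by (auto simp: le_fun_def deep_part_def dest: spec[of _ s])
  qed
  then have "is_supremum tree_lattice (spread ` range (deep_part k)) (spread (\<lambda>_. 1))"
    unfolding is_supremum_spread
    by (auto simp: tree_space_const) (auto simp: le_fun_def deep_part_def)
  then show ?thesis by (simp add: image_image)
qed

text \<open>
  The infimum in the definition of the Lorentz seminorm ranges over limits given by \<open>lim\<close>, so it is
  informative only once these limits are known to exist.
\<close>

lemma lorentz_limit:
  assumes g: "g \<in> tree_space" and xs: "\<forall>n. xs n \<in> carrier tree_lattice
      \<and> vle tree_lattice \<zero>\<^bsub>tree_lattice\<^esub> (xs n) \<and> vle tree_lattice (xs n) (xs (Suc n))"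
    and sup: "is_supremum tree_lattice (range xs) (spread g)"
  shows "(\<lambda>n. vnorm tree_lattice (xs n)) \<longlonglongrightarrow> lim (\<lambda>n. vnorm tree_lattice (xs n))"
    and "0 \<le> lim (\<lambda>n. vnorm tree_lattice (xs n))"
proof -
  define f where "f n = xs n \<circ> code" for n
  have f: "f n \<in> tree_space" and xs_eq: "xs n = spread (f n)" for n
    using xs by (auto simp: f_def image_iff) (metis spread_comp_code)+
  have pos: "0 \<le> f n s" and inc: "f n s \<le> f (Suc n) s" and le: "f n s \<le> g s" for n s
    using xs sup by (auto simp: xs_eq is_supremum_def le_fun_def)
  have "incseq (\<lambda>n. tree_norm (f n))"
  proof (rule incseq_SucI)
    show "tree_norm (f n) \<le> tree_norm (f (Suc n))" for n
      using pos inc by (intro tree_norm_mono f) (simp add: order_trans[OF pos inc])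
  qed
  moreover have "tree_norm (f n) \<le> tree_norm g" for n
    using order_trans[OF pos le] by (intro tree_norm_mono g) (simp add: pos le)
  ultimately have "convergent (\<lambda>n. tree_norm (f n))"
    using incseq_convergent by (metis convergent_def)
  then show *: "(\<lambda>n. vnorm tree_lattice (xs n)) \<longlonglongrightarrow> lim (\<lambda>n. vnorm tree_lattice (xs n))"
    by (simp add: xs_eq convergent_LIMSEQ_iff)
  show "0 \<le> lim (\<lambda>n. vnorm tree_lattice (xs n))"
    by (rule LIMSEQ_le_const[OF *]) (auto simp: xs_eq intro!: tree_norm_nonneg f)
qed

lemma lorentz_seminorm_one: "lorentz_seminorm tree_lattice (spread (\<lambda>_. 1)) = 0"
proof -
  let ?S = "{lim (\<lambda>n. vnorm tree_lattice (xs n)) | xs :: nat \<Rightarrow> _.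
      (\<forall>n. xs n \<in> carrier tree_lattice \<and> vle tree_lattice \<zero>\<^bsub>tree_lattice\<^esub> (xs n)
        \<and> vle tree_lattice (xs n) (xs (Suc n)))
      \<and> is_supremum tree_lattice (range xs) (spread (\<lambda>_. 1))}"
  have eq: "lorentz_seminorm tree_lattice (spread (\<lambda>_. 1)) = Inf ?S"
    by (simp add: lorentz_seminorm_def tree_space_const del: tree_lattice_simps)
  have nonneg: "0 \<le> a" if "a \<in> ?S" for a
    using that lorentz_limit(2)[OF tree_space_const] by blast
  have small: "\<exists>a\<in>?S. a \<le> 1 / 2 ^ Suc k" for k
  proof -
    let ?xs = "\<lambda>n. spread (deep_part k n)"
    have xs: "\<forall>n. ?xs n \<in> carrier tree_lattice \<and> vle tree_lattice \<zero>\<^bsub>tree_lattice\<^esub> (?xs n)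
        \<and> vle tree_lattice (?xs n) (?xs (Suc n))"
      by (auto simp: deep_part_in_tree_space) (auto simp: le_fun_def deep_part_def)
    have "lim (\<lambda>n. vnorm tree_lattice (?xs n)) \<le> 1 / 2 ^ Suc k"
      by (rule LIMSEQ_le_const2[OF lorentz_limit(1)[OF tree_space_const xs is_supremum_deep_part]])
        (use tree_norm_deep_part in auto)
    moreover have "lim (\<lambda>n. vnorm tree_lattice (?xs n)) \<in> ?S"
      using xs is_supremum_deep_part[of k] by (intro CollectI exI[of _ ?xs] conjI refl)
    ultimately show ?thesis by (rule bexI)
  qed
  then have ne: "?S \<noteq> {}" by blast
  have bdd: "bdd_below ?S" using nonneg by (intro bdd_belowI)
  have le: "Inf ?S \<le> (1 / 2) ^ Suc k" for k
    using small[of k] cInf_lower[OF _ bdd] by (fastforce simp: power_divide)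
  have "Inf ?S \<le> 0"
    by (rule LIMSEQ_le_const[OF LIMSEQ_Suc[OF LIMSEQ_power_zero[of "1 / 2 :: real"]]])
      (use le in auto)
  with cInf_greatest[OF ne nonneg] show ?thesis unfolding eq by (simp add: antisym)
qed

lemma lorentz_seminorm_not_norm: "\<not> norm_on tree_lattice (lorentz_seminorm tree_lattice)"
proof
  assume "norm_on tree_lattice (lorentz_seminorm tree_lattice)"
  then have "spread (\<lambda>_. 1 :: real) = \<zero>\<^bsub>tree_lattice\<^esub>"
    using lorentz_seminorm_one tree_space_const unfolding norm_on_def by auto
  then have "spread (\<lambda>_. 1 :: real) (code []) = spread (\<lambda>_. 0) (code [])"
    by (simp only: tree_lattice_simps)
  then show False by (simp only: spread_code one_neq_zero)
qed

section \<open>Order continuity\<close>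

lemma walk_mono:
  fixes f g :: "nat list \<Rightarrow> real"
  assumes "\<And>n. 0 \<le> v n" "f \<le> g"
  shows "walk v f \<le> walk v g"
proof (rule le_funI)
  show "walk v f s \<le> walk v g s" for s
    by (cases s) (use assms in \<open>auto simp: le_fun_def intro!: add_mono mult_left_mono\<close>)
qed

text \<open>
  Infima are not pointwise, so a lower bound \<open>w\<close> of the functions \<open>walk v f\<close> has to be transported
  back to lower bounds of \<open>D\<close>. Since \<open>D\<close> is directed, \<open>w (n # s) \<le> f s + v n * g (list_decode n @ s)\<close>
  holds for \<open>f\<close> and \<open>g\<close> chosen independently in \<open>D\<close>. For fixed \<open>g\<close> and \<open>n\<close> this is a lower bound for the
  functions \<open>f\<close> and disposes of the first summand; what remains is a lower bound for \<open>g\<close> on the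
  subtree at \<open>list_decode n\<close>, and continuing it by zero gives one for all of \<open>g\<close>.
\<close>

lemma walk_infimum:
  fixes D :: "(nat list \<Rightarrow> real) set"
  assumes v: "\<And>n. 0 \<le> v n"
    and D: "D \<subseteq> tree_space" "\<And>f g. f \<in> D \<Longrightarrow> g \<in> D \<Longrightarrow> \<exists>h\<in>D. h \<le> f \<and> h \<le> g" "D \<noteq> {}"
    and inf: "\<And>f. f \<in> D \<Longrightarrow> (\<lambda>_. 0) \<le> f" "\<And>w. w \<in> tree_space \<Longrightarrow> \<forall>f\<in>D. w \<le> f \<Longrightarrow> w \<le> (\<lambda>_. 0)"
    and w: "w \<in> tree_space" "\<And>f. f \<in> D \<Longrightarrow> w \<le> walk v f"
  shows "w \<le> (\<lambda>_. 0)"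
proof -
  have tail: "(\<lambda>s. w (n # s)) \<in> tree_space" for n
    using tree_space_prefix[OF w(1), of "[n]"] by simp
  have le: "w (n # s) \<le> f s + v n * g (list_decode n @ s)" if "f \<in> D" "g \<in> D" for n s f g
  proof -
    obtain h where h: "h \<in> D" "h \<le> f" "h \<le> g" using D(2) \<open>f \<in> D\<close> \<open>g \<in> D\<close> by blast
    have "w (n # s) \<le> h s + v n * h (list_decode n @ s)"
      using w(2)[OF h(1)] by (auto simp: le_fun_def dest: spec[of _ "n # s"])
    also have "\<dots> \<le> f s + v n * g (list_decode n @ s)"
      using h v by (intro add_mono mult_left_mono) (auto simp: le_fun_def)
    finally show ?thesis .
  qed
  have jump: "w (n # s) \<le> v n * g (list_decode n @ s)" if "g \<in> D" for n s g
  proof -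
    have "(\<lambda>s. w (n # s) - v n * g (list_decode n @ s)) \<le> (\<lambda>_. 0)"
    proof (rule inf(2))
      show "(\<lambda>s. w (n # s) - v n * g (list_decode n @ s)) \<in> tree_space"
        using that D(1) by (intro tree_space_diff tail tree_space_mult tree_space_prefix) auto
      show "\<forall>f\<in>D. (\<lambda>s. w (n # s) - v n * g (list_decode n @ s)) \<le> f"
        using le[OF _ that] by (auto simp: le_fun_def algebra_simps)
    qed
    then show ?thesis by (auto simp: le_fun_def dest: spec[of _ s])
  qed
  have cons: "w (n # s) \<le> 0" for n s
  proof (cases "v n = 0")
    case True
    obtain g where "g \<in> D" using D(3) by blast
    from jump[OF this, of n s] show ?thesis using True by simp
  next
    case False
    then have pos: "0 < v n" using v[of n] by simp
    \<comment> \<open>Dividing by \<open>v n\<close> is possible here, and grafting keeps \<open>z\<close> below all \<open>f\<close> since these are nonnegative.\<close>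
    define z where "z = graft (list_decode n) (\<lambda>s. (1 / v n) * w (n # s))"
    have "z \<le> (\<lambda>_. 0)"
    proof (rule inf(2))
      show "z \<in> tree_space"
        unfolding z_def by (intro graft_in_tree_space tree_space_mult tail)
      show "\<forall>f\<in>D. z \<le> f"
      proof (intro ballI le_funI)
        fix f u assume f: "f \<in> D"
        show "z u \<le> f u"
        proof (cases "take (length (list_decode n)) u = list_decode n")
          case True
          then have u: "u = list_decode n @ drop (length (list_decode n)) u"
            by (metis append_take_drop_id)
          show ?thesis
            using jump[OF f, of n "drop (length (list_decode n)) u"] pos unfolding z_def
            by (subst u, subst (2) u, subst graft_append) (simp add: field_simps)
        next
          case False
          then show ?thesis using inf(1)[OF f] by (simp add: z_def graft_def le_fun_def)
        qed
      qed
    qed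
    then have "z (list_decode n @ s) \<le> 0" by (auto simp: le_fun_def)
    then show ?thesis using pos by (simp add: z_def field_simps)
  qed
  have "w [] \<le> (\<lambda>_. 0) []"
    by (rule le_by_children[OF w(1) tree_space_const]) (use cons in simp)
  show ?thesis
  proof (rule le_funI)
    show "w s \<le> 0" for s
      using cons \<open>w [] \<le> (\<lambda>_. 0) []\<close> by (cases s) auto
  qed
qed

lemma order_continuous_walk:
  assumes v: "\<And>n. 0 \<le> v n" "\<And>n. v n \<le> jump_weight n"
  shows "order_continuous tree_lattice (lift (walk v))"
  unfolding order_continuous_def
proof (intro allI impI)
  fix I :: "((nat \<Rightarrow> real) \<Rightarrow> real) set" and r x
  assume "directed_index_set I r \<and> net_decreases_to_zero tree_lattice I r x"
  then have dir: "I \<noteq> {}" "\<And>i j. i \<in> I \<Longrightarrow> j \<in> I \<Longrightarrow> \<exists>k\<in>I. r i k \<and> r j k"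
    and x: "x \<in> I \<rightarrow> carrier tree_lattice"
    and dec: "\<And>i j. i \<in> I \<Longrightarrow> j \<in> I \<Longrightarrow> r i j \<Longrightarrow> vle tree_lattice (x j) (x i)"
    and inf: "is_infimum tree_lattice (x ` I) \<zero>\<^bsub>tree_lattice\<^esub>"
    unfolding directed_index_set_def net_decreases_to_zero_def by blast+
  define f where "f i = x i \<circ> code" for i
  have f: "f i \<in> tree_space" and x_eq: "x i = spread (f i)" if "i \<in> I" for i
    using funcset_mem[OF x that] by (auto simp: f_def)
  have img: "x ` I = spread ` (f ` I)" using x_eq by (auto simp: image_image intro!: image_cong)
  have img': "(\<lambda>i. lift (walk v) (x i)) ` I = spread ` (walk v ` f ` I)"
    using x_eq by (auto simp: image_image intro!: image_cong)
  have inf': "(\<forall>i\<in>I. (\<lambda>_. 0) \<le> f i) \<and> (\<forall>w\<in>tree_space. (\<forall>i\<in>I. w \<le> f i) \<longrightarrow> w \<le> (\<lambda>_. 0))"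
    using inf unfolding img tree_lattice_simps is_infimum_spread by auto
  have mem: "walk v (f i) \<in> tree_space" if "i \<in> I" for i
    using v f[OF that] by (intro walk_in_tree_space) (simp_all add: abs_of_nonneg)
  show "net_decreases_to_zero tree_lattice I r (\<lambda>i. lift (walk v) (x i))"
    unfolding net_decreases_to_zero_def
  proof (intro conjI ballI impI)
    show "(\<lambda>i. lift (walk v) (x i)) \<in> I \<rightarrow> carrier tree_lattice"
      using mem by (auto simp: x_eq)
    show "vle tree_lattice (lift (walk v) (x j)) (lift (walk v) (x i))" if "i \<in> I" "j \<in> I" "r i j" for i j
      using dec[OF that] that v(1) by (simp add: x_eq walk_mono)
    have pos: "(\<lambda>_. 0) \<le> walk v (f i)" if "i \<in> I" for i
      using walk_mono[of v "\<lambda>_. 0" "f i"] v(1) inf' that walk_diff[of v "f i" "f i"]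
      by (simp add: le_fun_def)
    have least: "w \<le> (\<lambda>_. 0)" if "w \<in> tree_space" "\<forall>i\<in>I. w \<le> walk v (f i)" for w
    proof (rule walk_infimum[of v "f ` I", OF v(1)])
      show "f ` I \<subseteq> tree_space" using f by blast
      show "\<exists>h\<in>f ` I. h \<le> a \<and> h \<le> b" if ab: "a \<in> f ` I" "b \<in> f ` I" for a b
      proof -
        obtain i j where ij: "i \<in> I" "j \<in> I" "a = f i" "b = f j" using ab by blast
        obtain k where k: "k \<in> I" "r i k" "r j k" using dir(2)[OF ij(1,2)] by blast
        then show ?thesis
          using dec[OF ij(1) k(1)] dec[OF ij(2) k(1)] ij by (auto simp: x_eq)
      qed
    qed (use dir(1) inf' that in auto)
    show "is_infimum tree_lattice ((\<lambda>i. lift (walk v) (x i)) ` I) \<zero>\<^bsub>tree_lattice\<^esub>"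
      unfolding img' tree_lattice_simps is_infimum_spread
      using pos least by (auto simp: tree_space_const)
  qed
qed

section \<open>Band irreducibility\<close>

lemma walk_zero_power: "(walk (\<lambda>_. 0) ^^ k) f s = f (drop k s)"
proof (induction k arbitrary: s)
  case (Suc k)
  show ?case by (cases s) (auto simp: Suc)
qed simp

text \<open>
  Positivity at \<open>t\<close> spreads to almost all children of \<open>t\<close>, and distinct words have distinct numbers.
\<close>

lemma infinite_jump_targets:
  fixes f :: "nat list \<Rightarrow> real"
  assumes "f \<in> tree_space" "0 < f t"
  shows "\<exists>\<^sub>F m in sequentially. 0 < f (list_decode m)"
proof -
  have "\<forall>\<^sub>F n in sequentially. 0 < f (t @ [n])"
    using tree_space_limit[OF assms(1)] assms(2) by (rule order_tendstoD)
  then obtain N where N: "\<And>n. n \<ge> N \<Longrightarrow> 0 < f (t @ [n])"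
    by (auto simp: eventually_sequentially)
  have "inj_on (\<lambda>n. list_encode (t @ [n])) {N..}"
    by (auto simp: inj_on_def list_encode_eq)
  then have "infinite ((\<lambda>n. list_encode (t @ [n])) ` {N..})"
    using finite_imageD infinite_Ici by blast
  moreover have "(\<lambda>n. list_encode (t @ [n])) ` {N..} \<subseteq> {m. 0 < f (list_decode m)}"
    using N by auto
  ultimately have "infinite {m. 0 < f (list_decode m)}"
    using infinite_super by blast
  then show ?thesis
    by (simp add: frequently_cofinite[symmetric] cofinite_eq_sequentially)
qed

text \<open>
  Let \<open>A\<close> and \<open>C\<close> be the two summands of the operator, both of which leave an invariant ideal invariant.
  If \<open>f \<ge> 0\<close> is a nonzero member, then \<open>C f\<close> is positive at \<open>[m]\<close> for infinitely many \<open>m\<close>, and the iterate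
  \<open>A ^ k (C f)\<close> with \<open>k = length s\<close>, which deletes \<open>k\<close> letters, is positive at the same children
  \<open>s @ [m]\<close> of \<open>s\<close>. So the members of the ideal are positive on a dense set, and the band they
  generate is the whole space.
\<close>

lemma band_irreducible_walk:
  "band_irreducible tree_lattice (lift (walk jump_weight))"
  unfolding band_irreducible_def
proof (intro allI impI)
  fix J assume J: "lattice_band tree_lattice J \<and> lift (walk jump_weight) ` J \<subseteq> J"
  interpret Module.module scalar_ring tree_lattice by (rule module_tree_lattice)
  have sub: "submodule J scalar_ring tree_lattice"
    and ideal: "\<And>x y. x \<in> J \<Longrightarrow> y \<in> carrier tree_lattice \<Longrightarrow>
      vle tree_lattice (modulus tree_lattice y) (modulus tree_lattice x) \<Longrightarrow> y \<in> J"
    and band: "\<And>D u. D \<subseteq> J \<Longrightarrow> is_supremum tree_lattice D u \<Longrightarrow> u \<in> J"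
    using J unfolding lattice_band_def lattice_ideal_def by blast+
  note closed = submoduleE[OF sub]
  have walk_J: "spread (walk jump_weight f) \<in> J" if "spread f \<in> J" for f
    using J that by (metis image_subset_iff lift_spread)
  define K where "K = {f \<in> tree_space. spread f \<in> J}"
  have J_eq: "J = spread ` K" using closed(1) by (auto simp: K_def)
  have K_tree: "f \<in> tree_space" if "f \<in> K" for f using that by (simp add: K_def)
  have K_ideal: "g \<in> K" if "f \<in> K" "g \<in> tree_space" "\<And>s. \<bar>g s\<bar> \<le> \<bar>f s\<bar>" for f g
    using ideal[of "spread f" "spread g"] that by (auto simp: K_def le_fun_def)
  have K_mult: "(\<lambda>s. c * f s) \<in> K" if "f \<in> K" for c f
    using closed(4)[of c "spread f"] that
    by (auto simp: K_def scalar_ring_def intro: tree_space_mult)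
  have K_diff: "(\<lambda>s. f s - g s) \<in> K" if "f \<in> K" "g \<in> K" for f g
    using closed(5)[of "spread f" "spread (\<lambda>s. (-1) * g s)"] that K_mult[of g "-1"]
    by (auto simp: K_def intro: tree_space_diff)
  have K_walk: "walk jump_weight f \<in> K" if "f \<in> K" for f
    using that walk_J jump_weight_pos
    by (auto simp: K_def abs_of_pos intro!: walk_in_tree_space)
  have K_sup: "u \<in> K" if "is_supremum tree_lattice (spread ` D) (spread u)" "D \<subseteq> K" for D u
    using band[OF _ that(1)] that by (auto simp: K_def is_supremum_spread)
  show "J = {\<zero>\<^bsub>tree_lattice\<^esub>} \<or> J = carrier tree_lattice"
  proof (cases "K \<subseteq> {\<lambda>_. 0}")
    case True
    moreover have "J \<noteq> {}" by (rule closed(2))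
    ultimately have "K = {\<lambda>_. 0}" unfolding J_eq by auto
    then show ?thesis by (simp add: J_eq)
  next
    case False
    then obtain f0 t where f0: "f0 \<in> K" "f0 t \<noteq> 0" by (auto simp: fun_eq_iff)
    define f where "f = (\<lambda>s. \<bar>f0 s\<bar>)"
    have f: "f \<in> K" "\<And>s. 0 \<le> f s" "0 < f t"
      using K_ideal[OF f0(1), of f] tree_space_norm[OF K_tree[OF f0(1)]] f0(2) by (auto simp: f_def)
    let ?A = "walk (\<lambda>_. 0) :: (nat list \<Rightarrow> real) \<Rightarrow> nat list \<Rightarrow> real"
    have A_tree: "?A g \<in> tree_space" if "g \<in> tree_space" for g
      using that less_imp_le[OF jump_weight_pos] by (intro walk_in_tree_space) simp_all
    have A_K: "?A g \<in> K" if g: "g \<in> K" "\<And>s. 0 \<le> g s" for g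
    proof (rule K_ideal[OF K_walk[OF g(1)] A_tree[OF K_tree[OF g(1)]]])
      show "\<bar>?A g s\<bar> \<le> \<bar>walk jump_weight g s\<bar>" for s
        using g(2) jump_weight_pos by (cases s) (auto simp: less_imp_le)
    qed
    define c where "c = (\<lambda>s. walk jump_weight f s - ?A f s)"
    have c: "c \<in> K" "\<And>s. 0 \<le> c s"
      unfolding c_def using f jump_weight_pos
      by (auto intro!: K_diff K_walk A_K) (case_tac s, auto simp: less_imp_le)
    have c_single: "c [m] = jump_weight m * f (list_decode m)" for m
      by (simp add: c_def)
    have pow: "(?A ^^ k) c \<in> K \<and> (\<forall>s. 0 \<le> (?A ^^ k) c s)" for k
    proof (induction k)
      case (Suc k)
      then have "(?A ^^ Suc k) c \<in> K" by (simp add: A_K)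
      moreover have "\<forall>s. 0 \<le> (?A ^^ Suc k) c s" by (simp only: walk_zero_power c(2) simp_thms)
      ultimately show ?case by blast
    qed (use c in auto)
    have pos_K: "g \<in> K" if g: "g \<in> tree_space" "\<And>s. 0 \<le> g s" for g
    proof (rule K_sup)
      \<comment> \<open>The order ideal below \<open>g\<close> attains the values of \<open>g\<close> on a dense set, which makes \<open>g\<close> its supremum.\<close>
      let ?D = "{d \<in> K. d \<le> g}"
      have "g s \<le> w s" if w: "w \<in> tree_space" "\<forall>d\<in>?D. d \<le> w" for w s
      proof (rule le_by_children[OF g(1) w(1)])
        have "g (s @ [m]) \<le> w (s @ [m])" if "0 < f (list_decode m)" for m
        proof -
          define h where "h = (?A ^^ length s) c"
          have h: "h \<in> K" "\<And>u. 0 \<le> h u" using pow by (auto simp: h_def)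
          have hm: "0 < h (s @ [m])"
            using that jump_weight_pos by (simp add: h_def walk_zero_power c_single)
          define q where "q = g (s @ [m]) / h (s @ [m])"
          have q: "0 \<le> q" using g(2) h(2) by (simp add: q_def)
          define d where "d = (\<lambda>u. min (g u) (q * h u))"
          have "d \<in> K"
          proof (rule K_ideal[OF K_mult[OF h(1), of q]])
            show "d \<in> tree_space"
              unfolding d_def by (intro tree_space_min tree_space_mult g K_tree h)
            show "\<bar>d u\<bar> \<le> \<bar>q * h u\<bar>" for u
              using g(2)[of u] h(2)[of u] q by (simp add: d_def)
          qed
          then have "d \<in> ?D" by (simp add: d_def le_fun_def)
          then have "d (s @ [m]) \<le> w (s @ [m])" using w(2) by (auto simp: le_fun_def)
          then show ?thesis using hm by (simp add: d_def q_def)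
        qed
        then show "\<exists>\<^sub>F m in sequentially. g (s @ [m]) \<le> w (s @ [m])"
          by (rule frequently_mono[rotated, OF infinite_jump_targets[OF K_tree[OF f(1)] f(3)], rule_format])
      qed
      then show "is_supremum tree_lattice (spread ` ?D) (spread g)"
        unfolding is_supremum_spread using g(1) by (auto simp: le_fun_def)
      show "?D \<subseteq> K" by blast
    qed
    have "g \<in> K" if g: "g \<in> tree_space" for g
      by (rule K_ideal[OF pos_K[OF tree_space_norm[OF g]] g]) auto
    then have "K = tree_space" using K_tree by blast
    then show ?thesis by (simp add: J_eq)
  qed
qed

section \<open>The complexification\<close>

text \<open>
  The complexification of the lattice of real functions is the space of complex functions; \<open>re_im\<close> is the
  isomorphism.
\<close>

definition re_im :: "(nat list \<Rightarrow> complex)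
    \<Rightarrow> ((nat \<Rightarrow> real) \<Rightarrow> real) \<times> ((nat \<Rightarrow> real) \<Rightarrow> real)" where
  "re_im h = (spread (\<lambda>s. Re (h s)), spread (\<lambda>s. Im (h s)))"

lemma re_im_eq_iff [simp]: "re_im g = re_im h \<longleftrightarrow> g = h"
proof
  assume "re_im g = re_im h"
  then have "(\<lambda>s. Re (g s)) = (\<lambda>s. Re (h s))" "(\<lambda>s. Im (g s)) = (\<lambda>s. Im (h s))"
    by (simp_all add: re_im_def)
  then show "g = h" by (auto simp: fun_eq_iff complex_eq_iff)
qed simp

lemma carrier_complex_lattice [simp]: "carrier complex_lattice = re_im ` tree_space"
proof -
  have "(spread f, spread g) \<in> re_im ` tree_space" if "f \<in> tree_space" "g \<in> tree_space" for f g
    using tree_space_Complex[OF that]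
    by (intro image_eqI[of _ _ "\<lambda>s. Complex (f s) (g s)"]) (simp_all add: re_im_def)
  then show ?thesis
    by (auto simp: complexification_def re_im_def tree_space_Re tree_space_Im)
qed

lemma complex_lattice_simps [simp]:
  "\<zero>\<^bsub>complex_lattice\<^esub> = re_im (\<lambda>_. 0)"
  "re_im g \<oplus>\<^bsub>complex_lattice\<^esub> re_im h = re_im (\<lambda>s. g s + h s)"
  by (simp_all add: complexification_def re_im_def)

lemma smult_complex_lattice [simp]:
  assumes "h \<in> tree_space"
  shows "c \<odot>\<^bsub>complex_lattice\<^esub> re_im h = re_im (\<lambda>s. c * h s)"
  using assms
  by (simp add: complexification_def re_im_def tree_space_mult tree_space_Re tree_space_Im add.commute)

lemma abelian_group_complex_lattice: "abelian_group complex_lattice"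
proof (rule abelian_groupI)
  fix x assume "x \<in> carrier complex_lattice"
  then obtain f where f: "x = re_im f" "f \<in> tree_space" by auto
  show "\<exists>y\<in>carrier complex_lattice. y \<oplus>\<^bsub>complex_lattice\<^esub> x = \<zero>\<^bsub>complex_lattice\<^esub>"
    by (rule bexI[of _ "re_im (\<lambda>s. - f s)"]) (auto simp: f intro!: imageI tree_space_uminus)
qed (auto simp: algebra_simps intro!: tree_space_add tree_space_const)

interpretation V: abelian_group complex_lattice
  by (rule abelian_group_complex_lattice)

lemma diff_re_im [simp]:
  assumes "f \<in> tree_space" "g \<in> tree_space"
  shows "re_im f \<ominus>\<^bsub>complex_lattice\<^esub> re_im g = re_im (\<lambda>s. f s - g s)"
proof -
  have "\<ominus>\<^bsub>complex_lattice\<^esub> re_im g = re_im (\<lambda>s. - g s)"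
    by (rule V.minus_equality) (use assms in \<open>auto intro!: imageI tree_space_uminus\<close>)
  then show ?thesis by (simp add: a_minus_def)
qed

lemma finsum_re_im:
  assumes "\<And>k. f k \<in> tree_space"
  shows "(\<Oplus>\<^bsub>complex_lattice\<^esub>k\<in>{..<n::nat}. re_im (f k)) = re_im (\<lambda>s. \<Sum>k<n. f k s)"
proof (induction n)
  case (Suc n)
  have "(\<Oplus>\<^bsub>complex_lattice\<^esub>k\<in>{..<Suc n}. re_im (f k))
      = re_im (f n) \<oplus>\<^bsub>complex_lattice\<^esub> (\<Oplus>\<^bsub>complex_lattice\<^esub>k\<in>{..<n}. re_im (f k))"
    unfolding lessThan_Suc by (rule V.finsum_insert) (use assms in auto)
  then show ?case by (simp add: Suc add.commute)
qed simp

text \<open>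
  The supremum is attained at every point, at the angle given by the argument of \<open>h s\<close>; it is
  therefore the pointwise modulus.
\<close>

lemma complex_modulus_re_im:
  assumes "h \<in> tree_space"
  shows "complex_modulus tree_lattice (re_im h) = spread (\<lambda>s. cmod (h s))"
proof -
  define rot where "rot = (\<lambda>t s. cos t * Re (h s) + sin t * Im (h s))"
  have upper: "rot t s \<le> cmod (h s)" for t s
  proof -
    have "rot t s = Re (cis (- t) * h s)" by (simp add: rot_def)
    also have "\<dots> \<le> cmod (cis (- t) * h s)" by (rule complex_Re_le_cmod)
    finally show ?thesis by (simp add: norm_mult)
  qed
  have attained: "\<exists>t. rot t s = cmod (h s)" for s
  proof -
    obtain r t where rt: "h s = rcis r t" "r = cmod (h s)" by (metis rcis_cmod_Arg)
    have "rot t s = r * ((cos t)\<^sup>2 + (sin t)\<^sup>2)"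
      by (simp only: rot_def rt(1) Re_rcis Im_rcis power2_eq_square algebra_simps)
    then show ?thesis using rt(2) by auto
  qed
  have "is_supremum tree_lattice (spread ` range rot) (spread (\<lambda>s. cmod (h s)))"
    unfolding is_supremum_spread
  proof (intro conjI ballI impI)
    show "(\<lambda>s. cmod (h s)) \<in> tree_space" by (rule tree_space_norm[OF assms])
    show "d \<le> (\<lambda>s. cmod (h s))" if "d \<in> range rot" for d
      using that upper by (auto simp: le_fun_def)
    show "(\<lambda>s. cmod (h s)) \<le> w" if "\<forall>d\<in>range rot. d \<le> w" for w
    proof (rule le_funI)
      fix s
      obtain t where "rot t s = cmod (h s)" using attained by blast
      then show "cmod (h s) \<le> w s" using that by (metis le_funD rangeI)
    qed
  qed
  then have "is_supremum tree_lattice (range (\<lambda>t. (cos t \<odot>\<^bsub>tree_lattice\<^esub> fst (re_im h))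
      \<oplus>\<^bsub>tree_lattice\<^esub> (sin t \<odot>\<^bsub>tree_lattice\<^esub> snd (re_im h)))) (spread (\<lambda>s. cmod (h s)))"
    by (simp add: re_im_def image_image rot_def)
  then show ?thesis unfolding complex_modulus_def by (blast intro: is_supremum_unique)
qed

lemma vnorm_re_im [simp]: "h \<in> tree_space \<Longrightarrow> vnorm complex_lattice (re_im h) = tree_norm h"
  by (simp add: complexification_def complex_modulus_re_im) (simp add: tree_norm_def)

lemma complexify_lift_walk [simp]:
  "complexify_operator (lift (walk v)) (re_im h) = re_im (walk v h)"
proof -
  have "walk v (\<lambda>s. Re (h s)) s = Re (walk v h s)" "walk v (\<lambda>s. Im (h s)) s = Im (walk v h s)" for s
    by (cases s; simp)+
  then show ?thesis by (auto simp: complexify_operator_def re_im_def)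
qed

definition lift_complex where
  "lift_complex T x = re_im (T (inv_into UNIV re_im x))"

lemma lift_complex_re_im [simp]: "lift_complex T (re_im h) = re_im (T h)"
  by (simp add: lift_complex_def inj_def)

lemma bounded_operator_lift_complex:
  assumes mem: "\<And>h. h \<in> tree_space \<Longrightarrow> T h \<in> tree_space"
    and linear: "\<And>g h a. g \<in> tree_space \<Longrightarrow> h \<in> tree_space \<Longrightarrow>
      T (\<lambda>s. g s + a * h s) = (\<lambda>s. T g s + a * T h s)"
    and bounded: "\<And>h s. h \<in> tree_space \<Longrightarrow> norm (T h s) \<le> K * tree_norm h * 2 ^ length s"
  shows "bounded_operator complex_lattice (lift_complex T)"
  unfolding bounded_operator_def linear_operator_def
proof (intro conjI exI[of _ K] ballI allI)
  have zero: "T (\<lambda>_. 0) = (\<lambda>_. 0)"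
    using linear[OF tree_space_const[of 0] tree_space_const[of 0], of "-1"] by simp
  show "lift_complex T \<in> carrier complex_lattice \<rightarrow> carrier complex_lattice"
    using mem by auto
  fix x assume "x \<in> carrier complex_lattice"
  then obtain g where g: "x = re_im g" "g \<in> tree_space" by auto
  show "lift_complex T (c \<odot>\<^bsub>complex_lattice\<^esub> x) = c \<odot>\<^bsub>complex_lattice\<^esub> lift_complex T x" for c
    using linear[OF tree_space_const g(2), of 0 c] g mem zero by simp
  show "vnorm complex_lattice (lift_complex T x) \<le> K * vnorm complex_lattice x"
    using bounded g mem by (auto intro!: tree_norm_le)
  fix y assume "y \<in> carrier complex_lattice"
  then obtain h where h: "y = re_im h" "h \<in> tree_space" by auto
  show "lift_complex T (x \<oplus>\<^bsub>complex_lattice\<^esub> y)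
      = lift_complex T x \<oplus>\<^bsub>complex_lattice\<^esub> lift_complex T y"
    using linear[OF g(2) h(2), of 1] g h by simp
qed

lemma operator_norm_bounds:
  assumes T: "\<And>h. h \<in> tree_space \<Longrightarrow> T (re_im h) = re_im (U h)"
    and mem: "\<And>h. h \<in> tree_space \<Longrightarrow> U h \<in> tree_space"
    and bounded: "\<And>h s. h \<in> tree_space \<Longrightarrow> norm (U h s) \<le> K * tree_norm h * 2 ^ length s"
    and K: "0 \<le> K"
  shows "0 \<le> operator_norm complex_lattice T" "operator_norm complex_lattice T \<le> K"
proof -
  let ?S = "{vnorm complex_lattice (T x) | x. x \<in> carrier complex_lattice \<and> vnorm complex_lattice x \<le> 1}"
  have S: "0 \<le> a \<and> a \<le> K" if "a \<in> ?S" for a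
  proof -
    obtain h where h: "h \<in> tree_space" "tree_norm h \<le> 1" "a = tree_norm (U h)"
    proof -
      obtain x where x: "x \<in> carrier complex_lattice" "vnorm complex_lattice x \<le> 1"
        "a = vnorm complex_lattice (T x)"
        using \<open>a \<in> ?S\<close> by blast
      then obtain h where "x = re_im h" "h \<in> tree_space" by auto
      with x that show ?thesis by (simp add: T mem)
    qed
    have "tree_norm (U h) \<le> K * tree_norm h" using bounded h(1) by (intro tree_norm_le)
    also have "\<dots> \<le> K * 1" by (rule mult_left_mono[OF h(2) K])
    finally show ?thesis using tree_norm_nonneg[OF mem[OF h(1)]] h(3) by simp
  qed
  have "tree_norm (\<lambda>_. 0 :: complex) \<le> 1" by (intro tree_norm_le) simp
  then have zero: "vnorm complex_lattice (T (re_im (\<lambda>_. 0))) \<in> ?S"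
    using tree_space_const[of "0 :: complex"] by (intro CollectI exI[of _ "re_im (\<lambda>_. 0)"]) auto
  have "bdd_above ?S" using S by (intro bdd_aboveI) blast
  from cSup_upper[OF zero this] S[OF zero] show "0 \<le> operator_norm complex_lattice T"
    unfolding operator_norm_def by linarith
  show "operator_norm complex_lattice T \<le> K"
    unfolding operator_norm_def using zero S by (intro cSup_least) blast+
qed

section \<open>Spectrum and pole\<close>

context small_walk
begin

abbreviation "T \<equiv> complexify_operator (lift (walk v))"

lemma resolvent_set_walk:
  assumes c: "3 / 4 < norm c" "c \<noteq> 1"
  shows "c \<in> resolvent_set complex_lattice T"
  unfolding resolvent_set_def
proof (intro CollectI exI[of _ "lift_complex (walk_resolvent c)"] conjI ballI)
  show "bounded_operator complex_lattice (lift_complex (walk_resolvent c))"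
    by (rule bounded_operator_lift_complex[OF walk_resolvent_in_tree_space[OF c]
          walk_resolvent_linear[OF c] norm_walk_resolvent_le[OF c(1)]])
  fix x assume "x \<in> carrier complex_lattice"
  then obtain h where h: "x = re_im h" "h \<in> tree_space" by auto
  note mem = tree_space_mult walk_in_tree_space[OF small] walk_resolvent_in_tree_space[OF c]
  show "lift_complex (walk_resolvent c) (c \<odot>\<^bsub>complex_lattice\<^esub> x \<ominus>\<^bsub>complex_lattice\<^esub> T x) = x"
    using walk_resolvent_left[OF c h(2)] h by (simp add: mem)
  show "c \<odot>\<^bsub>complex_lattice\<^esub> lift_complex (walk_resolvent c) x
      \<ominus>\<^bsub>complex_lattice\<^esub> T (lift_complex (walk_resolvent c) x) = x"
    using walk_resolvent_right[OF c h(2)] h by (simp add: mem)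
qed

text \<open>
  Evaluation at the empty word is an eigenfunctional for the eigenvalue 1, so that the constant
  function 1 is not in the range of \<open>1 - walk v\<close>.
\<close>

lemma one_in_spectrum: "1 \<notin> resolvent_set complex_lattice T"
proof
  assume "1 \<in> resolvent_set complex_lattice T"
  then obtain S where S: "bounded_operator complex_lattice S"
    and right: "\<And>x. x \<in> carrier complex_lattice \<Longrightarrow>
      1 \<odot>\<^bsub>complex_lattice\<^esub> S x \<ominus>\<^bsub>complex_lattice\<^esub> T (S x) = x"
    unfolding resolvent_set_def by blast
  have e: "re_im (\<lambda>_. 1) \<in> carrier complex_lattice" by (simp add: tree_space_const)
  then have "S (re_im (\<lambda>_. 1)) \<in> carrier complex_lattice"
    using S unfolding bounded_operator_def linear_operator_def by blast
  then obtain h where h: "S (re_im (\<lambda>_. 1)) = re_im h" "h \<in> tree_space" by auto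
  have "(\<lambda>s. h s - walk v h s) = (\<lambda>_. 1)"
    using right[OF e] h by (simp add: walk_in_tree_space[OF small])
  from fun_cong[OF this, of "[]"] show False by simp
qed

lemma spectral_radius_walk: "op_spectral_radius tree_lattice (lift (walk v)) = 1"
  unfolding op_spectral_radius_def
proof (rule cSup_eq_maximum)
  show "1 \<in> cmod ` op_spectrum complex_lattice T"
    using one_in_spectrum by (intro image_eqI[of _ _ 1]) (simp_all add: op_spectrum_def)
  fix a assume "a \<in> cmod ` op_spectrum complex_lattice T"
  then obtain c where c: "a = cmod c" "c \<notin> resolvent_set complex_lattice T"
    by (auto simp: op_spectrum_def)
  show "a \<le> 1"
  proof (rule ccontr)
    assume "\<not> a \<le> 1"
    then have "3 / 4 < cmod c" "c \<noteq> 1" using c(1) by auto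
    with resolvent_set_walk c(2) show False by blast
  qed
qed

lemma op_resolvent_walk:
  assumes c: "3 / 4 < norm c" "c \<noteq> 1" and h: "h \<in> tree_space"
  shows "op_resolvent complex_lattice c T (re_im h) = re_im (walk_resolvent c h)"
  unfolding op_resolvent_def
proof (rule inv_into_f_eq)
  note mem = tree_space_mult walk_in_tree_space[OF small] walk_resolvent_in_tree_space[OF c]
  show "inj_on (\<lambda>x. c \<odot>\<^bsub>complex_lattice\<^esub> x \<ominus>\<^bsub>complex_lattice\<^esub> T x) (carrier complex_lattice)"
    unfolding carrier_complex_lattice
  proof (intro inj_onI, elim imageE)
    fix x y f g
    assume "c \<odot>\<^bsub>complex_lattice\<^esub> x \<ominus>\<^bsub>complex_lattice\<^esub> T x
        = c \<odot>\<^bsub>complex_lattice\<^esub> y \<ominus>\<^bsub>complex_lattice\<^esub> T y"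
      and fg: "x = re_im f" "y = re_im g" "f \<in> tree_space" "g \<in> tree_space"
    then have "(\<lambda>s. c * f s - walk v f s) = (\<lambda>s. c * g s - walk v g s)"
      by (simp add: mem)
    then have "f = g" by (intro shift_inj_on[OF c fg(3,4)]) (rule fun_cong)
    then show "x = y" using fg by simp
  qed
  show "re_im (walk_resolvent c h) \<in> carrier complex_lattice"
    using mem h by simp
  show "c \<odot>\<^bsub>complex_lattice\<^esub> re_im (walk_resolvent c h)
      \<ominus>\<^bsub>complex_lattice\<^esub> T (re_im (walk_resolvent c h)) = re_im h"
    using walk_resolvent_right[OF c h] by (simp add: mem h)
qed

text \<open>
  The coefficient with number \<open>j\<close> has norm at most a constant times \<open>4 ^ j\<close>, since \<open>neumann 1\<close> has norm
  at most \<open>1 / (1 - 3 / 4)\<close>. The expansion converges for \<open>4 * cmod (c - 1) < 1\<close>, and the radius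
  \<open>1 / 8\<close> also keeps \<open>cmod c\<close> above \<open>3 / 4\<close>.
\<close>

lemma resolvent_pole_walk: "resolvent_pole_of_order complex_lattice T 1 1"
  unfolding resolvent_pole_of_order_def
proof (intro conjI exI[of _ "1 / 8 :: real"] exI[of _ "\<lambda>k. lift_complex (laurent_coeff k)"] allI impI)
  show "bounded_operator complex_lattice (lift_complex (laurent_coeff k))" for k
    by (rule bounded_operator_lift_complex[OF laurent_coeff_in_tree_space laurent_coeff_linear
          norm_laurent_coeff_le])
  have "laurent_coeff 0 fixed_vector [] \<noteq> 0"
    by (simp add: laurent_coeff_def fixed_vector)
  then have "laurent_coeff 0 fixed_vector \<noteq> (\<lambda>_. 0)" by auto
  then show "\<exists>x\<in>carrier complex_lattice. lift_complex (laurent_coeff 0) x \<noteq> \<zero>\<^bsub>complex_lattice\<^esub>"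
    by (intro bexI[of _ "re_im fixed_vector"]) (simp_all add: fixed_vector)
  fix c :: complex assume near: "0 < cmod (c - 1) \<and> cmod (c - 1) < 1 / 8"
  have c: "3 / 4 < norm c" "c \<noteq> 1"
    using near norm_triangle_ineq4[of c "c - 1"] by auto
  show "c \<in> resolvent_set complex_lattice T" by (rule resolvent_set_walk[OF c])
  let ?E = "\<lambda>n. operator_norm complex_lattice (\<lambda>x. op_resolvent complex_lattice c T x
      \<ominus>\<^bsub>complex_lattice\<^esub> (\<Oplus>\<^bsub>complex_lattice\<^esub>k\<in>{..<n}.
        ((c - 1) powi (int k - int 1)) \<odot>\<^bsub>complex_lattice\<^esub> lift_complex (laurent_coeff k) x))"
  define M where "M = (1 + tree_norm fixed_vector) / (norm c - 3 / 4)"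
  have M: "0 \<le> M" using c(1) tree_norm_nonneg[OF fixed_vector(1)] by (simp add: M_def)
  let ?rem = "\<lambda>n h s. walk_resolvent c h s - (\<Sum>k<Suc n. (c - 1) powi (int k - 1) * laurent_coeff k h s)"
  have bound: "0 \<le> ?E (Suc n) \<and> ?E (Suc n) \<le> (4 * norm (c - 1)) ^ n * M" for n
  proof -
    have mem: "(\<lambda>s. \<Sum>k<Suc n. (c - 1) powi (int k - 1) * laurent_coeff k h s) \<in> tree_space"
      if "h \<in> tree_space" for h
      by (intro tree_space_sum tree_space_mult laurent_coeff_in_tree_space that)
    have T: "op_resolvent complex_lattice c T (re_im h) \<ominus>\<^bsub>complex_lattice\<^esub>
        (\<Oplus>\<^bsub>complex_lattice\<^esub>k\<in>{..<Suc n}.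
          ((c - 1) powi (int k - int 1)) \<odot>\<^bsub>complex_lattice\<^esub> lift_complex (laurent_coeff k) (re_im h))
        = re_im (?rem n h)" if h: "h \<in> tree_space" for h
      using mem[OF h] walk_resolvent_in_tree_space[OF c h]
      by (simp add: op_resolvent_walk[OF c h] laurent_coeff_in_tree_space[OF h]
          finsum_re_im tree_space_mult del: sum.lessThan_Suc)
    have rem_mem: "?rem n h \<in> tree_space" if "h \<in> tree_space" for h
      by (intro tree_space_diff walk_resolvent_in_tree_space c that mem)
    have rem_le: "norm (?rem n h s) \<le> (4 * norm (c - 1)) ^ n * M * tree_norm h * 2 ^ length s"
      if "h \<in> tree_space" for h s
      using norm_laurent_remainder_le[OF c that] by (simp add: M_def)
    show ?thesis
      by (intro conjI operator_norm_bounds[OF T rem_mem rem_le])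
        (use M in auto)
  qed
  have "(\<lambda>n. (4 * norm (c - 1)) ^ n * M) \<longlonglongrightarrow> 0"
    using near by (intro tendsto_mult_left_zero LIMSEQ_power_zero) simp
  then have "(\<lambda>n. ?E (Suc n)) \<longlonglongrightarrow> 0"
    by (rule tendsto_sandwich[OF always_eventually always_eventually tendsto_const, rotated 2])
      (use bound in blast)+
  then show "?E \<longlonglongrightarrow> 0" by (rule LIMSEQ_imp_Suc)
qed simp_all

end

lemma positive_walk:
  assumes v: "\<And>n. 0 \<le> v n" "\<And>n. v n \<le> jump_weight n"
  shows "positive_operator tree_lattice (lift (walk v))"
  unfolding positive_operator_def linear_operator_def operator_le_def
proof (intro conjI ballI allI impI)
  have mem: "walk v f \<in> tree_space" if "f \<in> tree_space" for f :: "nat list \<Rightarrow> real"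
    using v that by (intro walk_in_tree_space) (simp_all add: abs_of_nonneg)
  show "lift (walk v) \<in> carrier tree_lattice \<rightarrow> carrier tree_lattice"
    using mem by auto
  fix x assume "x \<in> carrier tree_lattice"
  then obtain f where f: "x = spread f" "f \<in> tree_space" by auto
  show "lift (walk v) (c \<odot>\<^bsub>tree_lattice\<^esub> x) = c \<odot>\<^bsub>tree_lattice\<^esub> lift (walk v) x" for c
    by (simp add: f ext[OF walk_mult])
  show "vle tree_lattice \<zero>\<^bsub>tree_lattice\<^esub> (lift (walk v) x)"
    if "vle tree_lattice \<zero>\<^bsub>tree_lattice\<^esub> x"
    using walk_mono[of v "\<lambda>_. 0" f] v(1) that walk_diff[of v f f] by (simp add: f le_fun_def)
  fix y assume "y \<in> carrier tree_lattice"
  then obtain g where g: "y = spread g" "g \<in> tree_space" by auto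
  show "lift (walk v) (x \<oplus>\<^bsub>tree_lattice\<^esub> y)
      = lift (walk v) x \<oplus>\<^bsub>tree_lattice\<^esub> lift (walk v) y"
    by (simp add: f g ext[OF walk_add])
qed

section \<open>The counterexample\<close>

theorem mainTheorem2:
  shows "\<exists>(X :: ((nat \<Rightarrow> real) \<Rightarrow> real) normed_lattice) A B.
    banach_lattice X \<and>
    \<not> norm_on X (lorentz_seminorm X) \<and>
    positive_operator X A \<and> positive_operator X B \<and>
    operator_le X (\<lambda>_. \<zero>\<^bsub>X\<^esub>) A \<and> operator_le X A B \<and>
    op_spectral_radius X A = 1 \<and> op_spectral_radius X B = 1 \<and>
    resolvent_pole_of_order (complexification X) (complexify_operator B)
      (complex_of_real (op_spectral_radius X B)) 1 \<and>
    order_continuous X B \<and>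
    band_irreducible X B \<and>
    (\<exists>x\<in>carrier X. A x \<noteq> B x)"
proof (intro exI conjI)
  let ?A = "lift (walk (\<lambda>_. 0))" and ?B = "lift (walk jump_weight)"
  note pos = less_imp_le[OF jump_weight_pos]
  interpret A: small_walk "\<lambda>_. 0" by unfold_locales (simp add: pos)
  interpret B: small_walk jump_weight by unfold_locales (simp add: pos)
  show "banach_lattice tree_lattice" by (rule banach_lattice_tree_lattice)
  show "\<not> norm_on tree_lattice (lorentz_seminorm tree_lattice)"
    by (rule lorentz_seminorm_not_norm)
  show A: "positive_operator tree_lattice ?A" and "positive_operator tree_lattice ?B"
    by (intro positive_walk; simp add: pos)+
  show "operator_le tree_lattice (\<lambda>_. \<zero>\<^bsub>tree_lattice\<^esub>) ?A"
    using A by (simp add: positive_operator_def)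
  show "operator_le tree_lattice ?A ?B"
    unfolding operator_le_def
  proof (intro ballI impI)
    fix x assume "x \<in> carrier tree_lattice" and "vle tree_lattice \<zero>\<^bsub>tree_lattice\<^esub> x"
    then obtain f where f: "x = spread f" "\<And>s. 0 \<le> f s" by (auto simp: le_fun_def)
    have "walk (\<lambda>_. 0) f s \<le> walk jump_weight f s" for s
      using f(2) pos by (cases s) auto
    then show "vle tree_lattice (?A x) (?B x)" by (simp add: f(1) le_fun_def)
  qed
  show "op_spectral_radius tree_lattice ?A = 1" by (rule A.spectral_radius_walk)
  show B: "op_spectral_radius tree_lattice ?B = 1" by (rule B.spectral_radius_walk)
  show "resolvent_pole_of_order complex_lattice (complexify_operator ?B)
      (complex_of_real (op_spectral_radius tree_lattice ?B)) 1"
    using B.resolvent_pole_walk by (simp add: B)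
  show "order_continuous tree_lattice ?B" by (rule order_continuous_walk) (simp_all add: pos)
  show "band_irreducible tree_lattice ?B" by (rule band_irreducible_walk)
  have "walk (\<lambda>_. 0) (\<lambda>_. 1 :: real) [0] \<noteq> walk jump_weight (\<lambda>_. 1) [0]"
    using jump_weight_pos[of 0] by simp
  then have "walk (\<lambda>_. 0) (\<lambda>_. 1 :: real) \<noteq> walk jump_weight (\<lambda>_. 1)"
    by metis
  then show "\<exists>x\<in>carrier tree_lattice. ?A x \<noteq> ?B x"
    by (intro bexI[of _ "spread (\<lambda>_. 1)"]) (simp_all add: tree_space_const)
qed

end
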